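(* Let the discrete velocity field $\mathbf{u}_h$ be defined in a space $\mathbb{V}_{u_h}$ of vector-valued functions whose normal component is continuous across interior mesh facets and vanishes at boundary facets. Let $(\phi_h,\mathbf{j}_h,\mu_h,\boldsymbol{\sigma}_h)$ be a solution of the upwind mixed DG semi-discretization (DG-CH-flow) of the Cahn–Hilliard equation with transport described in the context, with forcing term $S$. Then, up to the forcing term $S$, total mass is conserved: $$\frac{d}{dt}\int_\Omega\phi_h\,dx=\int_\Omega S\,dx .$$
   Context: Setting. $\Omega$ is a bounded (polygonal or polyhedral, Lipschitz) domain with outward unit normal $\mathbf{n}$ on $\partial\Omega$, equipped with a finite element mesh. $\Gamma$ is the set of all interior facets of the mesh. $\langle\cdot,\cdot\rangle$ denotes the $L^2(\Omega)$ inner product of scalar or vector fields. $\epsilon>0$ is a constant. The diffusion coefficient is a positive function $d(\phi)>0$, assumed continuous in its argument. $S$ is a given forcing term, $S(t)\in L^2(\Omega)$. Continuous problem being discretized. $$\frac{\partial\phi}{\partial t}-\nabla\cdot\big(d(\phi)\nabla(\phi^3-\phi-\epsilon^2\Delta\phi)\big)+\nabla\cdot(\mathbf{u}\phi)=S,$$ with homogeneous Neumann boundary conditions $\mathbf{n}\cdot\nabla\phi=0$ and $\mathbf{n}\cdot\nabla\mu=0$ on $\partial\Omega$, where $\mu=\phi^3-\phi-\epsilon^2\Delta\phi$, and free-slip condition $\mathbf{u}\cdot\mathbf{n}=0$ on $\partial\Omega$. Discrete spaces. $\mathbb{V}_{H(\mathrm{div})}\subset H(\mathrm{div};\Omega)$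 and $\mathbb{V}_{DG}\subset L^2(\Omega)$ are finite-dimensional compatible finite element spaces of piecewise polynomials on the mesh (the last two spaces of a discrete de Rham complex). In particular $\nabla\cdot$ maps $\mathbb{V}_{H(\mathrm{div})}$ into $\mathbb{V}_{DG}$, elements of $\mathbb{V}_{H(\mathrm{div})}$ have continuous normal components across interior mesh facets, and $\mathbb{V}_{DG}$ is a discontinuous Galerkin space (no inter-element continuity) that contains the constants. $\mathring{\mathbb{V}}_{H(\mathrm{div})}$ is the subspace of those $\mathbf{w}\in\mathbb{V}_{H(\mathrm{div})}$ with $\mathbf{w}\cdot\mathbf{n}=0$ on $\partial\Omega$. Facet notation. The two sides of each interior facet are arbitrarily labelled $+$ and $-$, with facet normals $\mathbf{n}^+=-\mathbf{n}^-$, where $\mathbf{n}^\pm$ points outward from the cell on side $\pm$. Superscripts $\pm$ denote traces from the respective sides. For a vector field $\mathbf{v}$ the jump is $$[\![\mathbf{v}]\!]=\mathbf{v}^+\cdot\mathbf{n}^++\mathbf{v}^-\cdot\mathbf{n}^-.$$ For a scalar field $\psi$ the upwind value is $$\tilde\psi=s(\mathbf{u}_h)^+\psi^++s(\mathbf{u}_h)^-\psi^-,\qquad s(\mathbf{u}_h)=\tfrac12\big(\mathrm{sign}(\mathbf{u}_h\cdot\mathbf{n})+1\big).$$ $\nabla_h$ denotes the element-wise gradient. Semi-discretization (DG-CH-flow). Given the velocity field $\mathbf{u}_h$ (in $\mathbb{V}_{u_h}$, with the traces and integrals below well-defined), continuous in time, find $(\phi_h,\mathbf{j}_h,\mu_h,\boldsymbol{\sigma}_h)\in(\mathbb{V}_{DG},\mathring{\mathbb{V}}_{H(\mathrm{div})},\mathbb{V}_{DG},\mathring{\mathbb{V}}_{H(\mathrm{div})})$,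 with $\phi_h$ differentiable in time, such that at each time $$\Big\langle\psi,\tfrac{\partial\phi_h}{\partial t}+\nabla\cdot\mathbf{j}_h\Big\rangle-\langle\nabla_h\psi,\mathbf{u}_h\phi_h\rangle+\int_\Gamma[\![\mathbf{u}_h\psi]\!]\,\tilde\phi_h\,dS=\langle\psi,S\rangle\quad\forall\psi\in\mathbb{V}_{DG},$$ $$\Big\langle\tfrac{1}{d(\phi_h)}\mathbf{v},\mathbf{j}_h\Big\rangle-\langle\nabla\cdot\mathbf{v},\mu_h\rangle=0\quad\forall\mathbf{v}\in\mathring{\mathbb{V}}_{H(\mathrm{div})},$$ $$\langle\psi,\mu_h-\phi_h^3+\phi_h+\epsilon^2\nabla\cdot\boldsymbol{\sigma}_h\rangle=0\quad\forall\psi\in\mathbb{V}_{DG},$$ $$\langle\mathbf{v},\boldsymbol{\sigma}_h\rangle+\langle\nabla\cdot\mathbf{v},\phi_h\rangle=0\quad\forall\mathbf{v}\in\mathring{\mathbb{V}}_{H(\mathrm{div})}.$$ (In the facet integral, $dS$ is the surface measure, unrelated to the forcing $S$.) *)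

theory Defs
  imports "HOL-Analysis.Analysis"
begin

section \<open>Domain and mesh\<close>

text \<open>Near each boundary point the domain is the strict epigraph, in some direction \<open>e\<close>, of a
  Lipschitz function of the component orthogonal to \<open>e\<close>.\<close>

definition lipschitz_domain :: "'a::euclidean_space set \<Rightarrow> bool" where
  "lipschitz_domain \<Omega> \<longleftrightarrow> open \<Omega> \<and> connected \<Omega> \<and> bounded \<Omega> \<and> \<Omega> \<noteq> {} \<and>
     (\<forall>x\<in>frontier \<Omega>. \<exists>r>0. \<exists>e C g. norm e = 1 \<and> C-lipschitz_on UNIV g \<and>
        (\<forall>y\<in>ball x r. y \<in> \<Omega> \<longleftrightarrow> g (y - (y \<bullet> e) *\<^sub>R e) < y \<bullet> e))"

text \<open>The cells are closed polytopes. That such a mesh exists is what makes \<open>\<Omega>\<close> polygonal or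
  polyhedral.\<close>

definition fe_mesh :: "'a::euclidean_space set \<Rightarrow> 'a set set \<Rightarrow> bool" where
  "fe_mesh \<Omega> \<T> \<longleftrightarrow> finite \<T> \<and> \<Union>\<T> = closure \<Omega> \<and>
     (\<forall>K\<in>\<T>. polytope K \<and> interior K \<noteq> {}) \<and>
     (\<forall>K\<in>\<T>. \<forall>L\<in>\<T>. K \<noteq> L \<longrightarrow> (K \<inter> L) face_of K \<and> (K \<inter> L) face_of L)"

definition interior_facets :: "'a::euclidean_space set set \<Rightarrow> 'a set set" where
  "interior_facets \<T> = {F. \<exists>K\<in>\<T>. \<exists>L\<in>\<T>. K \<noteq> L \<and> F facet_of K \<and> F facet_of L}"

text \<open>An arbitrary labelling of the two cells sharing an interior facet.\<close>

definition facet_labelling ::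
    "'a::euclidean_space set set \<Rightarrow> ('a set \<Rightarrow> 'a set) \<Rightarrow> ('a set \<Rightarrow> 'a set) \<Rightarrow> bool" where
  "facet_labelling \<T> Kp Km \<longleftrightarrow> (\<forall>F\<in>interior_facets \<T>.
     Kp F \<in> \<T> \<and> Km F \<in> \<T> \<and> Kp F \<noteq> Km F \<and> F facet_of Kp F \<and> F facet_of Km F)"

definition outer_normal :: "'a::euclidean_space set \<Rightarrow> 'a set \<Rightarrow> 'a" where
  "outer_normal K F =
     (THE n. norm n = 1 \<and> (\<exists>b. K \<subseteq> {x. n \<bullet> x \<le> b} \<and> F = K \<inter> {x. n \<bullet> x = b}))"

text \<open>Surface measure on the hyperplane \<open>{x. n \<bullet> x = b}\<close>, \<open>n\<close> a unit vector: the area of a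
  set is the volume of the right prism of height one over it. The completion turns this Borel
  measure into the Lebesgue measure of the hyperplane.\<close>

definition hyperplane_measure :: "'a::euclidean_space \<Rightarrow> real \<Rightarrow> 'a measure" where
  "hyperplane_measure n b = completion
     (distr (restrict_space lborel {x. b \<le> n \<bullet> x \<and> n \<bullet> x \<le> b + 1}) borel
        (\<lambda>x. x - (n \<bullet> x - b) *\<^sub>R n))"

text \<open>A facet lies in a single hyperplane, and the choice between the two descriptions
  \<open>(n, b)\<close> and \<open>(- n, - b)\<close> of it is immaterial.\<close>

definition facet_measure :: "'a::euclidean_space set \<Rightarrow> 'a measure" where
  "facet_measure F =
     (let (n, b) = (SOME (n, b). norm n = 1 \<and> F \<subseteq> {x. n \<bullet> x = b})
      in restrict_space (hyperplane_measure n b) F)"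


section \<open>Function spaces\<close>

definition square_integrable ::
    "'a::euclidean_space set \<Rightarrow> ('a \<Rightarrow> 'b::euclidean_space) \<Rightarrow> bool" where
  "square_integrable \<Omega> f \<longleftrightarrow> f \<in> borel_measurable (lebesgue_on \<Omega>) \<and>
     integrable (lebesgue_on \<Omega>) (\<lambda>x. (norm (f x))\<^sup>2)"

definition ip :: "'a::euclidean_space set \<Rightarrow> ('a \<Rightarrow> 'b::euclidean_space) \<Rightarrow> ('a \<Rightarrow> 'b) \<Rightarrow> real" where
  "ip \<Omega> f g = (\<integral>x. f x \<bullet> g x \<partial>lebesgue_on \<Omega>)"

definition l2norm :: "'a::euclidean_space set \<Rightarrow> ('a \<Rightarrow> 'b::euclidean_space) \<Rightarrow> real" where
  "l2norm \<Omega> f = sqrt (ip \<Omega> f f)"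

definition function_space :: "('a \<Rightarrow> 'b::real_vector) set \<Rightarrow> bool" where
  "function_space V \<longleftrightarrow> (\<lambda>_. 0) \<in> V \<and> (\<forall>f\<in>V. \<forall>g\<in>V. (\<lambda>x. f x + g x) \<in> V) \<and>
     (\<forall>c. \<forall>f\<in>V. (\<lambda>x. c *\<^sub>R f x) \<in> V)"

definition fin_dim_function_space :: "('a \<Rightarrow> 'b::real_vector) set \<Rightarrow> bool" where
  "fin_dim_function_space V \<longleftrightarrow>
     (\<exists>B. finite B \<and> V = {\<lambda>x. \<Sum>b\<in>B. c b *\<^sub>R b x |c. True})"

coinductive smooth :: "('a::euclidean_space \<Rightarrow> real) \<Rightarrow> bool" where
  "\<lbrakk>\<forall>x. f differentiable (at x); \<forall>v. smooth (\<lambda>x. frechet_derivative f (at x) v)\<rbrakk> \<Longrightarrow> smooth f"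

definition test_function :: "'a::euclidean_space set \<Rightarrow> ('a \<Rightarrow> real) \<Rightarrow> bool" where
  "test_function \<Omega> \<theta> \<longleftrightarrow> smooth \<theta> \<and> (\<exists>C. compact C \<and> C \<subseteq> \<Omega> \<and> (\<forall>x. x \<notin> C \<longrightarrow> \<theta> x = 0))"

definition gradient :: "('a::euclidean_space \<Rightarrow> real) \<Rightarrow> 'a \<Rightarrow> 'a" where
  "gradient f x = (THE D. GDERIV f x :> D)"

definition has_weak_divergence ::
    "'a::euclidean_space set \<Rightarrow> ('a \<Rightarrow> 'a) \<Rightarrow> ('a \<Rightarrow> real) \<Rightarrow> bool" where
  "has_weak_divergence \<Omega> v g \<longleftrightarrow> square_integrable \<Omega> g \<and>
     (\<forall>\<theta>. test_function \<Omega> \<theta> \<longrightarrow> ip \<Omega> g \<theta> = - ip \<Omega> v (gradient \<theta>))"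

definition Hdiv :: "'a::euclidean_space set \<Rightarrow> ('a \<Rightarrow> 'a) set" where
  "Hdiv \<Omega> = {v. square_integrable \<Omega> v \<and> (\<exists>g. has_weak_divergence \<Omega> v g)}"

text \<open>The weak divergence is determined up to null sets only; it occurs below under integrals
  over \<open>\<Omega>\<close>.\<close>

definition weak_div :: "'a::euclidean_space set \<Rightarrow> ('a \<Rightarrow> 'a) \<Rightarrow> 'a \<Rightarrow> real" where
  "weak_div \<Omega> v = (SOME g. has_weak_divergence \<Omega> v g)"


section \<open>Traces on facets\<close>

text \<open>The trace from the cell \<open>K\<close> is the limit from inside \<open>K\<close>; values of \<open>f\<close> on the mesh
  skeleton itself play no role.\<close>

definition side_trace :: "'a::euclidean_space set \<Rightarrow> ('a \<Rightarrow> 'b::t2_space) \<Rightarrow> 'a \<Rightarrow> 'b" where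
  "side_trace K f x = Lim (at x within interior K) f"

definition has_facet_traces :: "'a::euclidean_space set set \<Rightarrow> ('a \<Rightarrow> 'b::t2_space) \<Rightarrow> bool" where
  "has_facet_traces \<T> f \<longleftrightarrow> (\<forall>K\<in>\<T>. \<forall>F. F facet_of K \<longrightarrow>
     (AE x in facet_measure F. \<exists>l. (f \<longlongrightarrow> l) (at x within interior K)))"

definition normal_continuous :: "'a::euclidean_space set set \<Rightarrow> ('a \<Rightarrow> 'a) \<Rightarrow> bool" where
  "normal_continuous \<T> v \<longleftrightarrow> (\<forall>K\<in>\<T>. \<forall>L\<in>\<T>. \<forall>F. K \<noteq> L \<and> F facet_of K \<and> F facet_of L \<longrightarrow>
     (AE x in facet_measure F.
        side_trace K v x \<bullet> outer_normal K F = side_trace L v x \<bullet> outer_normal K F))"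

definition normal_vanishes ::
    "'a::euclidean_space set \<Rightarrow> 'a set set \<Rightarrow> ('a \<Rightarrow> 'a) \<Rightarrow> bool" where
  "normal_vanishes \<Omega> \<T> v \<longleftrightarrow> (\<forall>K\<in>\<T>. \<forall>F. F facet_of K \<and> F \<subseteq> frontier \<Omega> \<longrightarrow>
     (AE x in facet_measure F. side_trace K v x \<bullet> outer_normal K F = 0))"

definition jump ::
    "('a::euclidean_space set \<Rightarrow> 'a set) \<Rightarrow> ('a set \<Rightarrow> 'a set) \<Rightarrow> 'a set \<Rightarrow> ('a \<Rightarrow> 'a) \<Rightarrow> 'a \<Rightarrow> real" where
  "jump Kp Km F v x =
     side_trace (Kp F) v x \<bullet> outer_normal (Kp F) F +
     side_trace (Km F) v x \<bullet> outer_normal (Km F) F"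

text \<open>The switch \<open>s(u)\<close> on either side uses the outward normal of the cell on that side.\<close>

definition upwind_switch :: "'a::euclidean_space set \<Rightarrow> 'a set \<Rightarrow> ('a \<Rightarrow> 'a) \<Rightarrow> 'a \<Rightarrow> real" where
  "upwind_switch K F u x = (sgn (side_trace K u x \<bullet> outer_normal K F) + 1) / 2"

definition upwind ::
    "('a::euclidean_space set \<Rightarrow> 'a set) \<Rightarrow> ('a set \<Rightarrow> 'a set) \<Rightarrow> 'a set \<Rightarrow>
     ('a \<Rightarrow> 'a) \<Rightarrow> ('a \<Rightarrow> real) \<Rightarrow> 'a \<Rightarrow> real" where
  "upwind Kp Km F u \<psi> x =
     upwind_switch (Kp F) F u x * side_trace (Kp F) \<psi> x +
     upwind_switch (Km F) F u x * side_trace (Km F) \<psi> x"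


section \<open>Discrete spaces\<close>

definition piecewise_polynomial ::
    "'a::euclidean_space set set \<Rightarrow> ('a \<Rightarrow> 'b::euclidean_space) \<Rightarrow> bool" where
  "piecewise_polynomial \<T> f \<longleftrightarrow>
     (\<forall>K\<in>\<T>. \<exists>p. polynomial_function p \<and> (\<forall>x\<in>interior K. f x = p x))"

definition broken_gradient ::
    "'a::euclidean_space set set \<Rightarrow> ('a \<Rightarrow> real) \<Rightarrow> 'a \<Rightarrow> 'a" where
  "broken_gradient \<T> f x = (if \<exists>K\<in>\<T>. x \<in> interior K then gradient f x else 0)"

text \<open>Elements are representatives of \<open>L\<^sup>2\<close> classes, pinned down inside the cells and arbitrary
  on the mesh skeleton, so membership of constants and absence of inter-element continuity (the
  space splits into its restrictions to single cells) are stated inside the cells.\<close>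

definition DG_space :: "'a::euclidean_space set set \<Rightarrow> ('a \<Rightarrow> real) set \<Rightarrow> bool" where
  "DG_space \<T> V \<longleftrightarrow> fin_dim_function_space V \<and> (\<forall>\<psi>\<in>V. piecewise_polynomial \<T> \<psi>) \<and>
     (\<forall>\<psi>\<in>V. \<forall>K\<in>\<T>. \<exists>\<eta>\<in>V. \<forall>L\<in>\<T>. \<forall>x\<in>interior L. \<eta> x = (if L = K then \<psi> x else 0)) \<and>
     (\<forall>c. \<exists>\<psi>\<in>V. \<forall>K\<in>\<T>. \<forall>x\<in>interior K. \<psi> x = c)"

definition compatible_spaces ::
    "'a::euclidean_space set \<Rightarrow> 'a set set \<Rightarrow> ('a \<Rightarrow> 'a) set \<Rightarrow> ('a \<Rightarrow> real) set \<Rightarrow> bool" where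
  "compatible_spaces \<Omega> \<T> VH VD \<longleftrightarrow> DG_space \<T> VD \<and>
     fin_dim_function_space VH \<and> VH \<subseteq> Hdiv \<Omega> \<and>
     (\<forall>v\<in>VH. piecewise_polynomial \<T> v \<and> normal_continuous \<T> v) \<and>
     (\<forall>v\<in>VH. \<exists>g\<in>VD. has_weak_divergence \<Omega> v g)"

definition Hdiv0 ::
    "'a::euclidean_space set \<Rightarrow> 'a set set \<Rightarrow> ('a \<Rightarrow> 'a) set \<Rightarrow> ('a \<Rightarrow> 'a) set" where
  "Hdiv0 \<Omega> \<T> VH = {v\<in>VH. normal_vanishes \<Omega> \<T> v}"

definition velocity_space ::
    "'a::euclidean_space set \<Rightarrow> 'a set set \<Rightarrow> ('a \<Rightarrow> 'a) set \<Rightarrow> bool" where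
  "velocity_space \<Omega> \<T> VU \<longleftrightarrow> function_space VU \<and>
     (\<forall>v\<in>VU. square_integrable \<Omega> v \<and> has_facet_traces \<T> v \<and>
             normal_continuous \<T> v \<and> normal_vanishes \<Omega> \<T> v)"


section \<open>Time dependence and the semi-discretization\<close>

definition L2_continuous ::
    "'a::euclidean_space set \<Rightarrow> real set \<Rightarrow> (real \<Rightarrow> 'a \<Rightarrow> 'b::euclidean_space) \<Rightarrow> bool" where
  "L2_continuous \<Omega> I f \<longleftrightarrow>
     (\<forall>t\<in>I. ((\<lambda>s. l2norm \<Omega> (\<lambda>x. f s x - f t x)) \<longlongrightarrow> 0) (at t within I))"

text \<open>On a finite-dimensional space of functions all notions of differentiability in time
  coincide; the \<open>L\<^sup>2\<close> one does not depend on representatives.\<close>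

definition has_time_derivative ::
    "'a::euclidean_space set \<Rightarrow> real set \<Rightarrow> (real \<Rightarrow> 'a \<Rightarrow> real) \<Rightarrow> real \<Rightarrow> ('a \<Rightarrow> real) \<Rightarrow> bool" where
  "has_time_derivative \<Omega> I f t f' \<longleftrightarrow> square_integrable \<Omega> f' \<and>
     ((\<lambda>s. l2norm \<Omega> (\<lambda>x. (f s x - f t x) / (s - t) - f' x)) \<longlongrightarrow> 0) (at t within I)"

definition facet_flux ::
    "('a::euclidean_space set \<Rightarrow> 'a set) \<Rightarrow> ('a set \<Rightarrow> 'a set) \<Rightarrow> 'a set \<Rightarrow>
     ('a \<Rightarrow> 'a) \<Rightarrow> ('a \<Rightarrow> real) \<Rightarrow> ('a \<Rightarrow> real) \<Rightarrow> 'a \<Rightarrow> real" where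
  "facet_flux Kp Km F u \<phi> \<psi> x =
     jump Kp Km F (\<lambda>y. \<psi> y *\<^sub>R u y) x * upwind Kp Km F u \<phi> x"

definition DG_CH_flow ::
    "'a::euclidean_space set \<Rightarrow> 'a set set \<Rightarrow> ('a set \<Rightarrow> 'a set) \<Rightarrow> ('a set \<Rightarrow> 'a set) \<Rightarrow>
     ('a \<Rightarrow> 'a) set \<Rightarrow> ('a \<Rightarrow> real) set \<Rightarrow> real \<Rightarrow> (real \<Rightarrow> real) \<Rightarrow> real set \<Rightarrow>
     (real \<Rightarrow> 'a \<Rightarrow> 'a) \<Rightarrow> (real \<Rightarrow> 'a \<Rightarrow> real) \<Rightarrow>
     (real \<Rightarrow> 'a \<Rightarrow> real) \<Rightarrow> (real \<Rightarrow> 'a \<Rightarrow> 'a) \<Rightarrow> (real \<Rightarrow> 'a \<Rightarrow> real) \<Rightarrow> (real \<Rightarrow> 'a \<Rightarrow> 'a) \<Rightarrow> bool"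
  where
  "DG_CH_flow \<Omega> \<T> Kp Km VH VD \<epsilon> d I u S \<phi> j \<mu> \<sigma> \<longleftrightarrow>
    (\<forall>t\<in>I.
      \<phi> t \<in> VD \<and> j t \<in> Hdiv0 \<Omega> \<T> VH \<and> \<mu> t \<in> VD \<and> \<sigma> t \<in> Hdiv0 \<Omega> \<T> VH \<and>
      (\<exists>\<phi>'. has_time_derivative \<Omega> I \<phi> t \<phi>' \<and>
        (\<forall>\<psi>\<in>VD.
          ip \<Omega> \<psi> (\<lambda>x. \<phi>' x + weak_div \<Omega> (j t) x)
          - ip \<Omega> (broken_gradient \<T> \<psi>) (\<lambda>x. \<phi> t x *\<^sub>R u t x)
          + (\<Sum>F\<in>interior_facets \<T>. \<integral>x. facet_flux Kp Km F (u t) (\<phi> t) \<psi> x \<partial>facet_measure F)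
          = ip \<Omega> \<psi> (S t))) \<and>
      (\<forall>v\<in>Hdiv0 \<Omega> \<T> VH.
        ip \<Omega> (\<lambda>x. (1 / d (\<phi> t x)) *\<^sub>R v x) (j t) - ip \<Omega> (weak_div \<Omega> v) (\<mu> t) = 0) \<and>
      (\<forall>\<psi>\<in>VD.
        ip \<Omega> \<psi> (\<lambda>x. \<mu> t x - (\<phi> t x) ^ 3 + \<phi> t x + \<epsilon>\<^sup>2 * weak_div \<Omega> (\<sigma> t) x) = 0) \<and>
      (\<forall>v\<in>Hdiv0 \<Omega> \<T> VH.
        ip \<Omega> v (\<sigma> t) + ip \<Omega> (weak_div \<Omega> v) (\<phi> t) = 0))"

end

theory Submission
  imports Defs
begin

text \<open>Testing the evolution equation with the function \<open>\<psi>\<close> that is \<open>1\<close> inside every cell switches off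
  the transport. Its broken gradient is zero, and the jump of \<open>\<psi> u\<close> over an interior facet is the
  jump of \<open>u\<close>, which vanishes because the normal component of \<open>u\<close> is continuous there while the two
  outer normals are opposite (\<open>broken_gradient_one\<close>, \<open>facet_flux_one\<close>). What remains is
  \<open>\<integral> \<partial>\<phi>/\<partial>t + \<integral> div j = \<integral> S\<close>. The Cauchy-Schwarz inequality turns the derivative of \<open>\<phi>\<close> in
  \<open>L\<^sup>2\<close> into a derivative of the mass (\<open>integral_has_time_derivative\<close>), so everything rests on
  \<open>\<integral> div j = 0\<close> (\<open>total_divergence_zero\<close>).

  This is the divergence theorem for a field whose normal component vanishes on the boundary, but
  \<open>div j\<close> is a weak divergence and is known only through test functions. It can be evaluated without
  any surface integral: for smooth cutoffs \<open>\<theta>\<close> with compact support in \<open>\<Omega>\<close> that tend to \<open>1\<close> as a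
  width \<open>\<delta>\<close> tends to \<open>0\<close>, the integral of \<open>\<theta> div j\<close> is minus the integral of \<open>j \<bullet> \<nabla>\<theta>\<close>, and
  the latter has to be shown to vanish in the limit. Interior facets need no attention, since the
  weak divergence on all of \<open>\<Omega>\<close> already accounts for them.

  The gradient of \<open>\<theta>\<close> has size \<open>1/\<delta>\<close> in a layer of width \<open>\<delta>\<close> near the boundary, so the size alone
  does not suffice; the direction matters. The cutoffs are therefore assembled from the finitely
  many hyperplanes spanned by the facets. Let \<open>x\<close> be close to a single hyperplane.
  Then \<open>\<nabla>\<theta>\<close> is parallel to its normal (\<open>cutoff_gradient_parallel\<close>), and it is nonzero only
  if the part of the hyperplane next to \<open>x\<close> is contained in a boundary facet of the cell of \<open>x\<close>
  (\<open>crossing_wall\<close>, \<open>cutoff_eq_1\<close>). On that facet the normal component of the polynomial field \<open>j\<close>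
  vanishes, so it is \<open>O(\<delta>)\<close> at \<open>x\<close>, and \<open>j \<bullet> \<nabla>\<theta>\<close> stays bounded on a set whose volume tends to \<open>0\<close>
  (\<open>strip_measure_small\<close>). Near two hyperplanes only the bound \<open>O(1/\<delta>)\<close> is left, but the points
  close to both fill a volume \<open>o(\<delta>)\<close> (\<open>two_strips_measure_small\<close>).\<close>

section \<open>Smooth functions\<close>

lemma smooth_differentiable: "smooth f \<Longrightarrow> f differentiable (at x)"
  by (erule smooth.cases) simp

lemma smooth_frechet: "smooth f \<Longrightarrow> smooth (\<lambda>x. frechet_derivative f (at x) v)"
  by (erule smooth.cases) simp

text \<open>The coinductive definition of smoothness gives no closure properties directly: differentiating
  a product leaves the products and lands in sums of products. This is a class of functions that
  contains the smooth ones and is itself closed under differentiation, so that coinduction applies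
  to it.\<close>

inductive smooth_algebra :: "('a::euclidean_space \<Rightarrow> real) \<Rightarrow> bool" where
  base: "smooth f \<Longrightarrow> smooth_algebra f"
| const: "smooth_algebra (\<lambda>_. c)"
| ridge: "smooth f \<Longrightarrow> smooth_algebra (\<lambda>x. f (a \<bullet> x - b))"
| add: "smooth_algebra f \<Longrightarrow> smooth_algebra g \<Longrightarrow> smooth_algebra (\<lambda>x. f x + g x)"
| mult: "smooth_algebra f \<Longrightarrow> smooth_algebra g \<Longrightarrow> smooth_algebra (\<lambda>x. f x * g x)"

lemma frechet_smooth: "smooth f \<Longrightarrow> (f has_derivative frechet_derivative f (at x)) (at x)"
  using frechet_derivative_works smooth_differentiable by blast

lemma smooth_algebra_derivative:
  "smooth_algebra f \<Longrightarrow>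
     \<exists>f'. \<forall>x. (f has_derivative f' x) (at x) \<and> (\<forall>v. smooth_algebra (\<lambda>x. f' x v))"
proof (induction rule: smooth_algebra.induct)
  case (base f)
  then show ?case
    by (intro exI[of _ "\<lambda>x. frechet_derivative f (at x)"])
      (simp add: frechet_smooth smooth_algebra.base smooth_frechet)
next
  case (const c)
  show ?case by (intro exI[of _ "\<lambda>x v. 0"]) (auto intro: smooth_algebra.const)
next
  case (ridge f a b)
  have "((\<lambda>x. f (a \<bullet> x - b)) has_derivative
      (\<lambda>v. frechet_derivative f (at (a \<bullet> x - b)) (a \<bullet> v))) (at x)" for x
    by (rule has_derivative_compose[of "\<lambda>x. a \<bullet> x - b" "\<lambda>v. a \<bullet> v"])
      (auto intro!: derivative_eq_intros frechet_smooth ridge)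
  moreover have "smooth_algebra (\<lambda>x. frechet_derivative f (at (a \<bullet> x - b)) (a \<bullet> v))" for v
    by (intro smooth_algebra.ridge smooth_frechet ridge)
  ultimately show ?case
    by (intro exI[of _ "\<lambda>x v. frechet_derivative f (at (a \<bullet> x - b)) (a \<bullet> v)"]) blast
next
  case (add f g)
  then obtain f' g' where "\<forall>x. (f has_derivative f' x) (at x) \<and> (\<forall>v. smooth_algebra (\<lambda>x. f' x v))"
    "\<forall>x. (g has_derivative g' x) (at x) \<and> (\<forall>v. smooth_algebra (\<lambda>x. g' x v))" by auto
  then have "((\<lambda>x. f x + g x) has_derivative (\<lambda>v. f' x v + g' x v)) (at x)"
    "smooth_algebra (\<lambda>x. f' x v + g' x v)" for x v
    by (simp_all add: has_derivative_add smooth_algebra.add)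
  then show ?case
    by (intro exI[of _ "\<lambda>x v. f' x v + g' x v"]) blast
next
  case (mult f g)
  then obtain f' g' where "\<forall>x. (f has_derivative f' x) (at x) \<and> (\<forall>v. smooth_algebra (\<lambda>x. f' x v))"
    "\<forall>x. (g has_derivative g' x) (at x) \<and> (\<forall>v. smooth_algebra (\<lambda>x. g' x v))" by auto
  then have "((\<lambda>x. f x * g x) has_derivative (\<lambda>v. f x * g' x v + f' x v * g x)) (at x)"
    "smooth_algebra (\<lambda>x. f x * g' x v + f' x v * g x)" for x v
    using mult.hyps by (simp_all add: has_derivative_mult smooth_algebra.add smooth_algebra.mult)
  then show ?case
    by (intro exI[of _ "\<lambda>x v. f x * g' x v + f' x v * g x"]) blast
qed

lemma smooth_algebra_smooth: "smooth_algebra f \<Longrightarrow> smooth f"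
proof (coinduction arbitrary: f rule: smooth.coinduct)
  case (smooth f)
  then obtain f' where f': "\<And>x. (f has_derivative f' x) (at x)" "\<And>v. smooth_algebra (\<lambda>x. f' x v)"
    using smooth_algebra_derivative by blast
  moreover have "frechet_derivative f (at x) = f' x" for x
    using f'(1) frechet_derivative_at by metis
  ultimately show ?case by (auto simp: differentiable_def)
qed

lemma continuous_on_smooth: "smooth f \<Longrightarrow> continuous_on S f"
  by (meson continuous_at_imp_continuous_on differentiable_imp_continuous_within smooth_differentiable)

lemma smooth_const: "smooth (\<lambda>_. c)"
  by (rule smooth_algebra_smooth) (simp add: smooth_algebra.const)

lemma smooth_add: "smooth f \<Longrightarrow> smooth g \<Longrightarrow> smooth (\<lambda>x. f x + g x)"
  by (rule smooth_algebra_smooth) (simp add: smooth_algebra.add smooth_algebra.base)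

lemma smooth_mult: "smooth f \<Longrightarrow> smooth g \<Longrightarrow> smooth (\<lambda>x. f x * g x)"
  by (rule smooth_algebra_smooth) (simp add: smooth_algebra.mult smooth_algebra.base)

lemma smooth_ridge: "smooth f \<Longrightarrow> smooth (\<lambda>x. f (a \<bullet> x - b))"
  by (rule smooth_algebra_smooth) (simp add: smooth_algebra.ridge)

lemma smooth_sum: "(\<And>i. i \<in> I \<Longrightarrow> smooth (f i)) \<Longrightarrow> smooth (\<lambda>x. \<Sum>i\<in>I. f i x)"
  by (induction I rule: infinite_finite_induct) (auto intro: smooth_const smooth_add)

lemma smooth_prod: "(\<And>i. i \<in> I \<Longrightarrow> smooth (f i)) \<Longrightarrow> smooth (\<lambda>x. \<Prod>i\<in>I. f i x)"
  by (induction I rule: infinite_finite_induct) (auto intro: smooth_const smooth_mult)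

text \<open>All derivatives of \<open>F\<close> beyond the first are derivatives of \<open>f\<close>.\<close>

lemma smooth_antiderivative:
  assumes "\<And>t. (F has_real_derivative f t) (at t)" and "smooth f"
  shows "smooth F"
proof (rule smooth.intros)
  show "\<forall>t. F differentiable (at t)"
    using assms(1) has_field_derivative_imp_has_derivative by (meson differentiableI)
  have "frechet_derivative F (at t) = (\<lambda>v. f t * v)" for t
    using assms(1)[of t] frechet_derivative_at unfolding has_field_derivative_def by metis
  then show "\<forall>v. smooth (\<lambda>t. frechet_derivative F (at t) v)"
    using smooth_mult[OF assms(2) smooth_const] by simp
qed

section \<open>A smooth step\<close>

text \<open>The derivatives of \<open>exp (- 1 / t)\<close>, continued by zero to the negative half-line, are again of this
  form, with other polynomials \<open>p\<close>. The whole family is needed for the coinduction in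
  \<open>smooth_flat_germ\<close>.\<close>

definition flat_germ :: "real poly \<Rightarrow> real \<Rightarrow> real" where
  "flat_germ p t = (if t \<le> 0 then 0 else poly p (1 / t) * exp (- (1 / t)))"

lemma flat_germ_tendsto_0: "((\<lambda>t. poly p (1 / t) * exp (- (1 / t))) \<longlongrightarrow> 0) (at_right (0::real))"
proof -
  have "((\<lambda>s. \<Sum>i\<le>degree p. coeff p i * (s ^ i / exp s)) \<longlongrightarrow> (\<Sum>i\<le>degree p. coeff p i * 0)) at_top"
    by (intro tendsto_intros tendsto_power_div_exp_0)
  then have "((\<lambda>s. poly p s * exp (- s)) \<longlongrightarrow> 0) at_top"
    by (simp add: poly_altdef sum_distrib_right exp_minus divide_inverse mult.assoc)
  from filterlim_compose[OF this filterlim_inverse_at_top_right] show ?thesis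
    by (simp add: divide_inverse)
qed

text \<open>The only delicate point is \<open>t = 0\<close>, where the difference quotient is another function of the
  same kind, with \<open>p\<close> multiplied by the identity, and hence tends to zero.\<close>

lemma flat_germ_derivative:
  "(flat_germ p has_real_derivative flat_germ ([:0, 0, 1:] * (p - pderiv p)) t) (at t)"
proof -
  consider "t < 0" | "t = 0" | "t > 0" by linarith
  then show ?thesis
  proof cases
    case 1
    have "((\<lambda>_. 0) has_real_derivative flat_germ ([:0, 0, 1:] * (p - pderiv p)) t) (at t)"
      using 1 by (simp add: flat_germ_def)
    then show ?thesis
      by (rule has_field_derivative_transform_within_open[of _ _ _ "{..<0}"])
        (use 1 in \<open>auto simp: flat_germ_def\<close>)
  next
    case 2
    have r: "((\<lambda>h. flat_germ p h / h) \<longlongrightarrow> 0) (at_right 0)"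
    proof (rule tendsto_cong[THEN iffD1, OF _ flat_germ_tendsto_0[of "[:0, 1:] * p"]])
      show "\<forall>\<^sub>F h in at_right 0. poly ([:0, 1:] * p) (1 / h) * exp (- (1 / h)) = flat_germ p h / h"
        unfolding flat_germ_def eventually_at by (intro exI[of _ 1]) auto
    qed
    have l: "((\<lambda>h. flat_germ p h / h) \<longlongrightarrow> 0) (at_left 0)"
      by (rule tendsto_cong[THEN iffD1, OF _ tendsto_const])
        (auto simp: flat_germ_def eventually_at intro!: exI[of _ 1])
    have "((\<lambda>h. flat_germ p h / h) \<longlongrightarrow> 0) (at 0)"
      using l r filterlim_split_at by blast
    then show ?thesis using 2
      by (simp add: DERIV_def flat_germ_def)
  next
    case 3
    have "((\<lambda>t. poly p (1 / t) * exp (- (1 / t))) has_real_derivative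
        poly (pderiv p) (1 / t) * (- 1 / t\<^sup>2) * exp (- (1 / t)) + poly p (1 / t) * (exp (- (1 / t)) * (1 / t\<^sup>2))) (at t)"
      using 3 by (auto intro!: derivative_eq_intros simp: power2_eq_square)
    also have "poly (pderiv p) (1 / t) * (- 1 / t\<^sup>2) * exp (- (1 / t)) + poly p (1 / t) * (exp (- (1 / t)) * (1 / t\<^sup>2))
        = flat_germ ([:0, 0, 1:] * (p - pderiv p)) t"
      using 3 by (simp add: flat_germ_def field_simps power2_eq_square)
    finally show ?thesis
      by (rule has_field_derivative_transform_within_open[of _ _ _ "{0<..}"])
        (use 3 in \<open>auto simp: flat_germ_def\<close>)
  qed
qed

lemma smooth_flat_germ: "smooth (\<lambda>t. c * flat_germ p t)"
proof -
  have "smooth f" if "\<exists>c p. f = (\<lambda>t. c * flat_germ p t)" for f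
    using that
  proof (coinduction arbitrary: f rule: smooth.coinduct)
    case (smooth f)
    then obtain c p where f: "f = (\<lambda>t. c * flat_germ p t)" by blast
    define q where "q = [:0, 0, 1:] * (p - pderiv p)"
    have D: "(f has_derivative (\<lambda>v. (c * v) * flat_germ q t)) (at t)" for t
      unfolding f using DERIV_cmult[OF flat_germ_derivative[of p t], of c]
      by (rule has_derivative_eq_rhs[OF has_field_derivative_imp_has_derivative])
        (simp add: q_def fun_eq_iff)
    then have "frechet_derivative f (at t) = (\<lambda>v. (c * v) * flat_germ q t)" for t
      by (metis frechet_derivative_at)
    with D show ?case by (auto simp: differentiable_def)
  qed
  then show ?thesis by blast
qed

definition bump :: "real \<Rightarrow> real" where
  "bump t = flat_germ 1 (t - 1) * flat_germ 1 (2 - t)"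

lemma smooth_bump: "smooth bump"
proof -
  have f: "smooth (flat_germ 1)"
    using smooth_flat_germ[of 1 1] by simp
  show ?thesis
    using smooth_mult[OF smooth_ridge[OF f, of "1::real" 1] smooth_ridge[OF f, of "- 1 :: real" "- 2"]]
    by (simp add: bump_def[abs_def])
qed

lemma bump_nonneg: "0 \<le> bump t"
  by (simp add: bump_def flat_germ_def)

lemma bump_eq_0: "t \<notin> {1<..<2} \<Longrightarrow> bump t = 0"
  by (auto simp: bump_def flat_germ_def)

text \<open>As the bump vanishes outside \<open>[1, 2]\<close>, starting the integral at \<open>0\<close> captures all of it; for
  negative \<open>t\<close> the empty interval gives the correct value \<open>0\<close>.\<close>

definition bump_mass :: "real \<Rightarrow> real" where
  "bump_mass t = integral {0..t} bump"

lemma bump_integrable: "bump integrable_on {a..b}"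
  by (intro integrable_continuous_interval continuous_on_smooth smooth_bump)

lemma bump_mass_left: "t \<le> 1 \<Longrightarrow> bump_mass t = 0"
  unfolding bump_mass_def
  by (subst integral_cong[of _ _ "\<lambda>_. 0"]) (auto intro: bump_eq_0)

lemma bump_mass_derivative: "(bump_mass has_real_derivative bump t) (at t)"
proof (cases "t < 1")
  case True
  have "((\<lambda>_. 0) has_real_derivative bump t) (at t)"
    using True by (simp add: bump_eq_0)
  then show ?thesis
    by (rule has_field_derivative_transform_within_open[of _ _ _ "{..<1}"])
      (use True in \<open>auto simp: bump_mass_left\<close>)
next
  case False
  have "((\<lambda>t. integral {0..t} bump) has_real_derivative bump t) (at t within {0..t + 1})"
    using False by (intro integral_has_real_derivative continuous_on_smooth smooth_bump) auto
  moreover have "at t within {0..t + 1} = at t"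
    using False by (intro at_within_interior) auto
  ultimately show ?thesis
    by (simp add: bump_mass_def[abs_def])
qed

lemma bump_mass_mono: "s \<le> t \<Longrightarrow> bump_mass s \<le> bump_mass t"
  using DERIV_nonneg_imp_nondecreasing[of s t bump_mass] bump_mass_derivative bump_nonneg by blast

lemma bump_mass_right: assumes "2 \<le> t" shows "bump_mass t = bump_mass 2"
proof -
  have "bump_mass t = bump_mass 2 + integral {2..t} bump"
    unfolding bump_mass_def using assms
    by (intro Henstock_Kurzweil_Integration.integral_combine[symmetric] bump_integrable) auto
  moreover have "integral {2..t} bump = 0"
    by (subst integral_cong[of _ _ "\<lambda>_. 0"]) (auto intro: bump_eq_0)
  ultimately show ?thesis by simp
qed

lemma bump_mass_pos: "0 < bump_mass 2"
proof (rule ccontr)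
  assume "\<not> 0 < bump_mass 2"
  then have c: "bump_mass t = 0" if "t \<in> {1..2}" for t
    using bump_mass_mono[of 1 t] bump_mass_mono[of t 2] bump_mass_left[of 1] that by force
  have "((\<lambda>_. 0) has_real_derivative bump (3/2)) (at (3/2))"
    by (rule has_field_derivative_transform_within_open[OF bump_mass_derivative, where S = "{1<..<2}"])
      (auto simp: c)
  then have "bump (3/2) = 0"
    using DERIV_unique DERIV_const by blast
  then show False by (simp add: bump_def flat_germ_def)
qed

definition smooth_step :: "real \<Rightarrow> real" where
  "smooth_step t = bump_mass t / bump_mass 2"

lemma smooth_step_derivative: "(smooth_step has_real_derivative bump t / bump_mass 2) (at t)"
  unfolding smooth_step_def[abs_def] by (intro DERIV_cdivide bump_mass_derivative)

lemma smooth_smooth_step: "smooth smooth_step"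
  by (rule smooth_antiderivative[OF smooth_step_derivative])
    (use smooth_mult[OF smooth_bump smooth_const, of "1 / bump_mass 2"] in simp)

lemma smooth_step_left: "t \<le> 1 \<Longrightarrow> smooth_step t = 0"
  and smooth_step_right: "2 \<le> t \<Longrightarrow> smooth_step t = 1"
  using bump_mass_pos by (simp_all add: smooth_step_def bump_mass_left bump_mass_right[of t])

lemma smooth_step_range: "0 \<le> smooth_step t" "smooth_step t \<le> 1"
proof -
  have "smooth_step (min t 1) \<le> smooth_step t" "smooth_step t \<le> smooth_step (max t 2)"
    using bump_mass_pos by (simp_all add: smooth_step_def bump_mass_mono divide_right_mono)
  then show "0 \<le> smooth_step t" "smooth_step t \<le> 1"
    by (simp_all add: smooth_step_left smooth_step_right)
qed

lemma smooth_step_slope_bounded: "\<exists>M>0. \<forall>t. \<bar>bump t / bump_mass 2\<bar> \<le> M"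
proof -
  have "bounded (bump ` {1..2})"
    by (intro compact_imp_bounded compact_continuous_image continuous_on_smooth smooth_bump) simp
  then obtain B where B: "B > 0" "\<forall>t\<in>{1..2}. \<bar>bump t\<bar> \<le> B"
    using bounded_pos by (metis image_eqI real_norm_def)
  then have "\<bar>bump t\<bar> \<le> B" for t
    using bump_eq_0[of t] by (cases "t \<in> {1<..<2}") auto
  then show ?thesis
    using B bump_mass_pos by (intro exI[of _ "B / bump_mass 2"]) (simp add: divide_right_mono)
qed

text \<open>A partition of unity of the line into a part on the positive side (\<open>\<sigma> = 1\<close>), a part on the
  negative side (\<open>\<sigma> = - 1\<close>) and a part near zero (\<open>\<sigma> = 0\<close>). It is applied below to the signed
  distance from a hyperplane, measured in units of \<open>\<delta>\<close>.\<close>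

definition side_weight :: "real \<Rightarrow> real \<Rightarrow> real" where
  "side_weight \<sigma> \<tau> =
     (if \<sigma> = 1 then smooth_step \<tau> else if \<sigma> = - 1 then smooth_step (- \<tau>)
      else 1 - smooth_step \<tau> - smooth_step (- \<tau>))"

abbreviation signs :: "real set" where
  "signs \<equiv> {- 1, 0, 1}"

lemma side_weight_range: "0 \<le> side_weight \<sigma> \<tau>" "side_weight \<sigma> \<tau> \<le> 1"
  using smooth_step_range[of \<tau>] smooth_step_range[of "- \<tau>"] smooth_step_left[of \<tau>] smooth_step_left[of "- \<tau>"]
  by (cases "\<tau> \<le> 0"; force simp: side_weight_def)+

lemma side_weight_sum: "(\<Sum>\<sigma>\<in>signs. side_weight \<sigma> \<tau>) = 1"
  by (simp add: side_weight_def)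

lemma side_weight_far:
  assumes "\<bar>\<tau>\<bar> > 2" and "\<sigma> \<in> signs"
  shows "side_weight \<sigma> \<tau> = (if \<sigma> = sgn \<tau> then 1 else 0)"
  using assms by (cases "\<tau> > 0") (auto simp: side_weight_def smooth_step_left smooth_step_right)

lemma side_weight_support:
  assumes "side_weight \<sigma> \<tau> \<noteq> 0" and "\<sigma> \<in> signs"
  shows "(\<sigma> \<noteq> 0 \<longrightarrow> 1 \<le> \<sigma> * \<tau>) \<and> (\<sigma> = 0 \<longrightarrow> \<bar>\<tau>\<bar> \<le> 2)"
  using assms smooth_step_left[of \<tau>] smooth_step_left[of "- \<tau>"]
    smooth_step_right[of \<tau>] smooth_step_right[of "- \<tau>"]
  by (auto simp: side_weight_def split: if_splits; linarith)

lemma smooth_side_weight: "smooth (side_weight \<sigma>)"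
proof -
  have m: "smooth (\<lambda>t. smooth_step (- t))"
    using smooth_ridge[OF smooth_smooth_step, of "- 1 :: real" 0] by simp
  have "smooth (\<lambda>t. (1 + - 1 * smooth_step t) + - 1 * smooth_step (- t))"
    using smooth_add[OF smooth_add[OF smooth_const smooth_mult[OF smooth_const smooth_smooth_step]]
        smooth_mult[OF smooth_const m]] .
  with m smooth_smooth_step show ?thesis
    by (cases "\<sigma> = 1"; cases "\<sigma> = - 1") (simp_all add: side_weight_def[abs_def])
qed

lemma side_weight_slope_bounded:
  "\<exists>M>0. \<forall>\<sigma> \<tau>. \<exists>D. (side_weight \<sigma> has_real_derivative D) (at \<tau>) \<and> \<bar>D\<bar> \<le> M"
proof -
  obtain M where M: "M > 0" "\<And>t. \<bar>bump t / bump_mass 2\<bar> \<le> M"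
    using smooth_step_slope_bounded by blast
  let ?d = "\<lambda>t. bump t / bump_mass 2"
  have m: "((\<lambda>t. smooth_step (- t)) has_real_derivative - ?d (- t)) (at t)" for t
    using DERIV_chain2[OF smooth_step_derivative DERIV_minus[OF DERIV_ident]] by fastforce
  have "\<exists>D. (side_weight \<sigma> has_real_derivative D) (at \<tau>) \<and> \<bar>D\<bar> \<le> 2 * M" for \<sigma> \<tau>
  proof -
    consider "\<sigma> = 1" | "\<sigma> = - 1" | "\<sigma> \<noteq> 1" "\<sigma> \<noteq> - 1" by blast
    then show ?thesis
    proof cases
      case 1
      then show ?thesis
        using smooth_step_derivative[of \<tau>] M(1) M(2)[of \<tau>] by (force simp: side_weight_def[abs_def])
    next
      case 2
      then show ?thesis
        using m[of \<tau>] M(1) M(2)[of "- \<tau>"] by (force simp: side_weight_def[abs_def])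
    next
      case 3
      have "((\<lambda>t. 1 - smooth_step t - smooth_step (- t)) has_real_derivative (0 - ?d \<tau> - (- ?d (- \<tau>)))) (at \<tau>)"
        by (intro DERIV_diff DERIV_const smooth_step_derivative m)
      moreover have "\<bar>0 - ?d \<tau> - (- ?d (- \<tau>))\<bar> \<le> 2 * M"
        using M(2)[of \<tau>] M(2)[of "- \<tau>"] by linarith
      ultimately show ?thesis
        using 3 by (auto simp: side_weight_def[abs_def])
    qed
  qed
  with M(1) show ?thesis by (intro exI[of _ "2 * M"]) auto
qed

section \<open>Gradients and polynomials\<close>

lemma GDERIV_unique: "GDERIV f x :> D \<Longrightarrow> GDERIV f x :> E \<Longrightarrow> D = E"
proof -
  assume "GDERIV f x :> D" "GDERIV f x :> E"
  then have "(\<lambda>h. h \<bullet> D) = (\<lambda>h. h \<bullet> E)"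
    unfolding gderiv_def by (rule has_derivative_unique)
  then show "D = E" by (metis inner_commute vector_eq_ldot)
qed

lemma gradient_eq: "GDERIV f x :> D \<Longrightarrow> gradient f x = D"
  unfolding gradient_def by (rule the_equality) (assumption, rule GDERIV_unique)

lemma GDERIV_cong_open:
  assumes "GDERIV g x :> D" "open U" "x \<in> U" "\<And>y. y \<in> U \<Longrightarrow> f y = g y"
  shows "GDERIV f x :> D"
  unfolding gderiv_def
  by (rule has_derivative_transform_within_open[OF assms(1)[unfolded gderiv_def] assms(2,3)])
    (simp add: assms(4))

lemma GDERIV_sum:
  "(\<And>i. i \<in> I \<Longrightarrow> GDERIV (f i) x :> D i) \<Longrightarrow> GDERIV (\<lambda>x. \<Sum>i\<in>I. f i x) x :> (\<Sum>i\<in>I. D i)"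
  unfolding gderiv_def inner_sum_right by (rule has_derivative_sum)

lemma finite_uniform_bound:
  fixes Q :: "'i \<Rightarrow> real \<Rightarrow> bool"
  assumes "finite I" "\<And>i. i \<in> I \<Longrightarrow> \<exists>b. Q i b" and mono: "\<And>i b c. Q i b \<Longrightarrow> b \<le> c \<Longrightarrow> Q i c"
  shows "\<exists>b\<ge>0. \<forall>i\<in>I. Q i b"
  using assms(1,2)
proof (induction I rule: finite_induct)
  case empty
  then show ?case by auto
next
  case (insert i I)
  then obtain b where b: "b \<ge> 0" "\<forall>i\<in>I. Q i b" by blast
  obtain c where c: "Q i c" using insert.prems by blast
  with b show ?case
    by (intro exI[of _ "max b c"]) (auto intro: mono[of _ b] mono[of _ c])
qed

lemma real_polynomial_lipschitz:
  fixes q :: "'a::euclidean_space \<Rightarrow> real"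
  assumes "real_polynomial_function q"
  shows "\<exists>L\<ge>0. \<forall>x\<in>cball 0 R. \<forall>y\<in>cball 0 R. \<bar>q x - q y\<bar> \<le> L * norm (x - y)"
  using assms
proof (induction rule: real_polynomial_function.induct)
  case (linear f)
  then obtain L where "L > 0" "\<And>x. norm (f x) \<le> norm x * L"
    using bounded_linear.pos_bounded by blast
  then show ?case
    using linear by (intro exI[of _ L]) (auto simp: linear_diff[symmetric] bounded_linear.linear mult.commute)
next
  case (const c)
  show ?case by (intro exI[of _ 0]) simp
next
  case (add f g)
  then obtain L M where LM: "L \<ge> 0" "M \<ge> 0"
    "\<And>x y. x \<in> cball 0 R \<Longrightarrow> y \<in> cball 0 R \<Longrightarrow> \<bar>f x - f y\<bar> \<le> L * norm (x - y)"
    "\<And>x y. x \<in> cball 0 R \<Longrightarrow> y \<in> cball 0 R \<Longrightarrow> \<bar>g x - g y\<bar> \<le> M * norm (x - y)" by blast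
  have "\<bar>f x + g x - (f y + g y)\<bar> \<le> (L + M) * norm (x - y)" if "x \<in> cball 0 R" "y \<in> cball 0 R" for x y
    using LM(3)[OF that] LM(4)[OF that] by (simp add: distrib_right)
  with LM(1,2) show ?case by (intro exI[of _ "L + M"]) auto
next
  case (mult f g)
  then obtain L M where LM: "L \<ge> 0" "M \<ge> 0"
    "\<And>x y. x \<in> cball 0 R \<Longrightarrow> y \<in> cball 0 R \<Longrightarrow> \<bar>f x - f y\<bar> \<le> L * norm (x - y)"
    "\<And>x y. x \<in> cball 0 R \<Longrightarrow> y \<in> cball 0 R \<Longrightarrow> \<bar>g x - g y\<bar> \<le> M * norm (x - y)" by blast
  have bd: "\<exists>B>0. \<forall>x\<in>cball 0 R. \<bar>h x\<bar> \<le> B" if "real_polynomial_function h" for h :: "'a \<Rightarrow> real"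
  proof -
    have "continuous_on (cball 0 R) h"
      using that by (meson continuous_at_imp_continuous_on continuous_real_polymonial_function)
    then have "bounded (h ` cball 0 R)"
      by (intro compact_imp_bounded compact_continuous_image) auto
    then show ?thesis unfolding bounded_pos by (metis image_eqI real_norm_def)
  qed
  obtain B C where BC: "B > 0" "C > 0" "\<And>x. x \<in> cball 0 R \<Longrightarrow> \<bar>f x\<bar> \<le> B"
    "\<And>x. x \<in> cball 0 R \<Longrightarrow> \<bar>g x\<bar> \<le> C"
    using bd[OF mult.hyps(1)] bd[OF mult.hyps(2)] by metis
  have "\<bar>f x * g x - f y * g y\<bar> \<le> (L * C + B * M) * norm (x - y)"
    if xy: "x \<in> cball 0 R" "y \<in> cball 0 R" for x y
  proof -
    have "f x * g x - f y * g y = (f x - f y) * g x + f y * (g x - g y)"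
      by (simp add: algebra_simps)
    then have "\<bar>f x * g x - f y * g y\<bar> \<le> \<bar>f x - f y\<bar> * \<bar>g x\<bar> + \<bar>f y\<bar> * \<bar>g x - g y\<bar>"
      by (metis abs_mult abs_triangle_ineq)
    also have "\<dots> \<le> (L * norm (x - y)) * C + B * (M * norm (x - y))"
      using LM xy BC by (intro add_mono mult_mono) auto
    finally show ?thesis by (simp add: algebra_simps)
  qed
  with LM(1,2) BC(1,2) show ?case by (intro exI[of _ "L * C + B * M"]) auto
qed

lemma real_polynomial_function_inner:
  fixes p :: "'a::euclidean_space \<Rightarrow> 'b::euclidean_space"
  assumes "polynomial_function p"
  shows "real_polynomial_function (\<lambda>x. p x \<bullet> a)"
  using assms bounded_linear_inner_left[of a] by (auto simp: polynomial_function_def o_def)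

section \<open>Volumes of strips around hyperplanes\<close>

definition strip :: "'a::euclidean_space \<times> real \<Rightarrow> real \<Rightarrow> 'a set" where
  "strip p \<delta> = {x. \<bar>fst p \<bullet> x - snd p\<bar> \<le> \<delta>}"

abbreviation hyperplane :: "'a::euclidean_space \<times> real \<Rightarrow> 'a set" where
  "hyperplane p \<equiv> {x. fst p \<bullet> x = snd p}"

lemma closed_strip: "closed (strip p \<delta>)"
  unfolding strip_def by (intro closed_Collect_le continuous_intros)

lemma strip_mono: "\<delta> \<le> \<eta> \<Longrightarrow> strip p \<delta> \<subseteq> strip p \<eta>"
  by (auto simp: strip_def)

lemma lmeasurable_bounded_closed: "closed S \<Longrightarrow> S \<inter> cball 0 R \<in> lmeasurable"
  by (simp add: compact_Int_closed Int_commute lmeasurable_compact closed_Int_compact)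

text \<open>The strips shrink to a hyperplane, which is a null set, and within a ball the measure is
  continuous from above.\<close>

lemma strip_measure_small:
  fixes p :: "'a::euclidean_space \<times> real"
  assumes "norm (fst p) = 1" and "e > 0"
  shows "\<exists>\<eta>>0. \<forall>\<delta>\<le>\<eta>. measure lebesgue (strip p \<delta> \<inter> cball 0 R) \<le> e"
proof -
  define A where "A n = strip p (1 / real (Suc n)) \<inter> cball 0 R" for n
  have lm: "A n \<in> lmeasurable" for n
    unfolding A_def by (intro lmeasurable_bounded_closed closed_strip)
  have "decseq A"
    unfolding A_def by (intro decseq_SucI Int_mono strip_mono) (auto simp: field_simps)
  then have lim: "(\<lambda>n. measure lebesgue (A n)) \<longlonglongrightarrow> measure lebesgue (\<Inter>n. A n)"
    using lm by (intro Lim_measure_decseq)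
      (auto simp: fmeasurableD2 infinity_ennreal_def simp del: emeasure_completion dest: fmeasurableD)
  have "(\<Inter>n. A n) \<subseteq> hyperplane p"
  proof
    fix x assume x: "x \<in> (\<Inter>n. A n)"
    have "\<bar>fst p \<bullet> x - snd p\<bar> \<le> 0"
    proof (rule ccontr)
      assume "\<not> ?thesis"
      then obtain n where "inverse (real (Suc n)) < \<bar>fst p \<bullet> x - snd p\<bar>"
        using reals_Archimedean by (metis not_le)
      moreover have "x \<in> A n" using x by blast
      ultimately show False by (simp add: A_def strip_def divide_inverse)
    qed
    then show "x \<in> hyperplane p" by simp
  qed
  moreover have "negligible (hyperplane p)"
    using assms(1) by (intro negligible_hyperplane) auto
  ultimately have "measure lebesgue (\<Inter>n. A n) = 0"
    using negligible_imp_measure0 negligible_subset by blast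
  with lim \<open>e > 0\<close> obtain n where n: "measure lebesgue (A n) < e"
    by (metis (no_types, lifting) eventually_sequentially order_refl order_tendstoD(2))
  have "measure lebesgue (strip p \<delta> \<inter> cball 0 R) \<le> e" if "\<delta> \<le> 1 / real (Suc n)" for \<delta>
  proof -
    have "measure lebesgue (strip p \<delta> \<inter> cball 0 R) \<le> measure lebesgue (A n)"
      using strip_mono[OF that, of p] lm
      by (intro measure_mono_fmeasurable) (auto simp: A_def lmeasurable_bounded_closed closed_strip fmeasurableD)
    with n show ?thesis by simp
  qed
  then show ?thesis by (intro exI[of _ "1 / real (Suc n)"]) auto
qed

text \<open>Unit vectors that are not parallel are linearly independent; \<open>w\<close> is a multiple of the component
  of \<open>c\<close> orthogonal to \<open>a\<close>.\<close>

lemma transversal_direction: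
  fixes a c :: "'a::euclidean_space"
  assumes "norm a = 1" "norm c = 1" "c \<noteq> a" "c \<noteq> - a"
  obtains w where "a \<bullet> w = 0" "c \<bullet> w = 1"
proof
  define v where "v = c - (a \<bullet> c) *\<^sub>R a"
  have aa: "a \<bullet> a = 1" using assms(1) by (simp add: dot_square_norm)
  have v0: "v \<noteq> 0"
  proof
    assume "v = 0"
    then have c: "c = (a \<bullet> c) *\<^sub>R a" by (simp add: v_def)
    then have "norm c = \<bar>a \<bullet> c\<bar> * norm a" by (metis norm_scaleR)
    then have "a \<bullet> c = 1 \<or> a \<bullet> c = - 1" using assms(1,2) by auto
    with c assms show False by auto
  qed
  have av: "a \<bullet> v = 0" by (simp add: v_def inner_diff_right aa)
  have cv: "c \<bullet> v = v \<bullet> v"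
    using av by (simp add: v_def inner_diff_left inner_commute)
  show "a \<bullet> (v /\<^sub>R (v \<bullet> v)) = 0" "c \<bullet> (v /\<^sub>R (v \<bullet> v)) = 1"
    using v0 av cv by simp_all
qed

text \<open>The measure is \<open>o(\<delta>)\<close>. For parallel hyperplanes thin strips do not meet. Otherwise a packing
  argument avoids computing volumes: some vector \<open>w\<close> is tangent to the first hyperplane and
  transversal to the second. About \<open>1 / (3 \<delta>)\<close> translates of the intersection, by multiples of
  \<open>3 \<delta> w\<close>, are pairwise disjoint and still lie in a bounded part of the first strip, whose
  measure is \<open>o(1)\<close>.\<close>

lemma two_strips_measure_small:
  fixes p q :: "'a::euclidean_space \<times> real"
  assumes "norm (fst p) = 1" "norm (fst q) = 1" "hyperplane p \<noteq> hyperplane q" and "e > 0"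
  shows "\<exists>\<eta>>0. \<forall>\<delta>. 0 < \<delta> \<and> \<delta> \<le> \<eta> \<longrightarrow>
           measure lebesgue (strip p \<delta> \<inter> strip q \<delta> \<inter> cball 0 R) \<le> e * \<delta>"
proof (cases "fst q = fst p \<or> fst q = - fst p")
  case True
  then obtain s where s: "fst q = s *\<^sub>R fst p" "s = 1 \<or> s = - 1"
    by (metis scaleR_minus1_left scaleR_one)
  define g where "g = \<bar>snd p - s * snd q\<bar>"
  have "snd p \<noteq> s * snd q"
    using s assms(3) by auto
  then have g: "g > 0" by (simp add: g_def)
  have "strip p \<delta> \<inter> strip q \<delta> = {}" if "\<delta> \<le> g / 3" for \<delta>
  proof -
    have "g \<le> 2 * \<delta>" if "x \<in> strip p \<delta>" "x \<in> strip q \<delta>" for x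
      using that s(2) by (auto simp: strip_def g_def s(1))
    with that g show ?thesis by force
  qed
  then show ?thesis using g assms(4) by (intro exI[of _ "g / 3"]) auto
next
  case False
  then obtain w where w: "fst p \<bullet> w = 0" "fst q \<bullet> w = 1"
    using transversal_direction[of "fst p" "fst q"] assms by metis
  obtain \<eta> where \<eta>: "\<eta> > 0"
    "\<And>\<delta>. \<delta> \<le> \<eta> \<Longrightarrow> measure lebesgue (strip p \<delta> \<inter> cball 0 (R + norm w)) \<le> e / 6"
    using strip_measure_small[OF assms(1), of "e / 6" "R + norm w"] assms(4) by auto
  have "measure lebesgue (strip p \<delta> \<inter> strip q \<delta> \<inter> cball 0 R) \<le> e * \<delta>"
    if \<delta>: "0 < \<delta>" "\<delta> \<le> min \<eta> (1/6)" for \<delta>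
  proof -
    define P where "P = strip p \<delta> \<inter> strip q \<delta> \<inter> cball 0 R"
    define N where "N = nat \<lfloor>1 / (3 * \<delta>)\<rfloor>"
    define T where "T k = (+) ((real k * (3 * \<delta>)) *\<^sub>R w) ` P" for k :: nat
    have P: "P \<in> lmeasurable"
      unfolding P_def by (intro lmeasurable_bounded_closed closed_Int closed_strip)
    have N: "1 / (6 * \<delta>) \<le> real N" "real N * (3 * \<delta>) \<le> 1"
    proof -
      have "1 / (3 * \<delta>) < real N + 1" "real N \<le> 1 / (3 * \<delta>)"
        using \<delta> by (simp_all add: N_def)
      moreover have "1 \<le> 1 / (6 * \<delta>)" "1 / (3 * \<delta>) = 2 * (1 / (6 * \<delta>))"
        using \<delta> by (simp_all add: field_simps)
      ultimately show "1 / (6 * \<delta>) \<le> real N" "real N * (3 * \<delta>) \<le> 1"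
        using \<delta> by (linarith, simp add: field_simps)
    qed
    have T: "T k \<in> lmeasurable" "measure lebesgue (T k) = measure lebesgue P" for k
      unfolding T_def using P by (auto simp: measurable_translation measure_translation)
    \<comment> \<open>Translates with different indices lie in strips around different translates of the second
      hyperplane: their centres are at least \<open>3 \<delta>\<close> apart, their half-widths are \<open>\<delta>\<close>.\<close>
    have "disjoint_family_on T {..<N}"
    proof (unfold disjoint_family_on_def, intro ballI impI, rule ccontr)
      fix k l assume kl: "k \<noteq> l" "T k \<inter> T l \<noteq> {}"
      then obtain x y where x: "x \<in> P" and y: "y \<in> P"
        and eq: "(real k * (3 * \<delta>)) *\<^sub>R w + x = (real l * (3 * \<delta>)) *\<^sub>R w + y"
        unfolding T_def by blast
      from arg_cong[OF eq, of "\<lambda>z. fst q \<bullet> z"]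
      have "real k * (3 * \<delta>) + fst q \<bullet> x = real l * (3 * \<delta>) + fst q \<bullet> y"
        by (simp add: inner_add_right w)
      with x y have "\<bar>(real k - real l) * (3 * \<delta>)\<bar> \<le> 2 * \<delta>"
        by (simp add: P_def strip_def algebra_simps) linarith
      then have "\<bar>real k - real l\<bar> * (3 * \<delta>) \<le> 2 * \<delta>"
        using \<delta> by (simp add: abs_mult)
      moreover have "1 * (3 * \<delta>) \<le> \<bar>real k - real l\<bar> * (3 * \<delta>)"
        using kl(1) \<delta> by (intro mult_right_mono) linarith+
      ultimately show False using \<delta> by linarith
    qed
    then have "measure lebesgue (\<Union>k<N. T k) = (\<Sum>k<N. measure lebesgue (T k))"
      using T by (intro measure_finite_Union)
        (auto simp: fmeasurableD2 infinity_ennreal_def simp del: emeasure_completion dest: fmeasurableD)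
    then have "real N * measure lebesgue P = measure lebesgue (\<Union>k<N. T k)"
      by (simp add: T)
    also have "\<dots> \<le> measure lebesgue (strip p \<delta> \<inter> cball 0 (R + norm w))"
    proof (rule measure_mono_fmeasurable)
      show "(\<Union>k<N. T k) \<subseteq> strip p \<delta> \<inter> cball 0 (R + norm w)"
      proof safe
        fix k x assume k: "k < N" and "x \<in> T k"
        then obtain y where y: "y \<in> P" "x = (real k * (3 * \<delta>)) *\<^sub>R w + y"
          unfolding T_def by blast
        have "real k * (3 * \<delta>) \<le> real N * (3 * \<delta>)"
          using k \<delta> by (intro mult_right_mono) auto
        with N(2) have "real k * (3 * \<delta>) \<le> 1" by linarith
        then have "norm ((real k * (3 * \<delta>)) *\<^sub>R w) \<le> norm w"
          using \<delta> mult_right_mono[of "real k * (3 * \<delta>)" 1 "norm w"] by simp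
        with y show "x \<in> cball 0 (R + norm w)"
          using norm_triangle_ineq[of "(real k * (3 * \<delta>)) *\<^sub>R w" y] by (simp add: P_def)
        from y show "x \<in> strip p \<delta>"
          by (simp add: P_def strip_def inner_add_right w)
      qed
      show "(\<Union>k<N. T k) \<in> sets lebesgue"
        using T by (intro sets.finite_UN) (auto simp: fmeasurableD)
      show "strip p \<delta> \<inter> cball 0 (R + norm w) \<in> lmeasurable"
        by (intro lmeasurable_bounded_closed closed_strip)
    qed
    also have "\<dots> \<le> e / 6" using \<eta>(2) \<delta> by auto
    finally have "real N * measure lebesgue P \<le> e / 6" .
    moreover have "1 / (6 * \<delta>) * measure lebesgue P \<le> real N * measure lebesgue P"
      using N(1) by (intro mult_right_mono) auto
    ultimately have "1 / (6 * \<delta>) * measure lebesgue P \<le> e / 6" by linarith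
    with \<delta> show ?thesis by (simp add: P_def field_simps)
  qed
  with \<eta>(1) show ?thesis by (intro exI[of _ "min \<eta> (1/6)"]) auto
qed

section \<open>Cutoffs subordinate to a hyperplane arrangement\<close>

lemma sgn_times_self_pos: "r \<noteq> 0 \<Longrightarrow> 0 < sgn r * (r::real)"
  by (simp add: sgn_if)

abbreviation level :: "'a::euclidean_space \<times> real \<Rightarrow> 'a \<Rightarrow> real" where
  "level p x \<equiv> fst p \<bullet> x - snd p"

text \<open>A vector of signs \<open>s\<close> selects, for each hyperplane, one of its sides or the layer around it.
  The bounds are those given by the supports of the functions \<open>side_weight\<close>.\<close>

definition region :: "('a::euclidean_space \<times> real) set \<Rightarrow> real \<Rightarrow> ('a \<times> real \<Rightarrow> real) \<Rightarrow> 'a set" where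
  "region A \<delta> s = {x. \<forall>p\<in>A. (s p \<noteq> 0 \<longrightarrow> \<delta> \<le> s p * level p x) \<and> (s p = 0 \<longrightarrow> \<bar>level p x\<bar> \<le> 2 * \<delta>)}"

definition region_weight ::
    "('a::euclidean_space \<times> real) set \<Rightarrow> real \<Rightarrow> ('a \<times> real \<Rightarrow> real) \<Rightarrow> 'a \<Rightarrow> real" where
  "region_weight A \<delta> s x = (\<Prod>p\<in>A. side_weight (s p) (level p x / \<delta>))"

text \<open>Keeping exactly those sign vectors whose closed region lies in \<open>\<Omega>\<close> makes the support of their
  sum a compact subset of \<open>\<Omega>\<close>, if \<open>\<Omega>\<close> is bounded.\<close>

definition inner_signs ::
    "('a::euclidean_space \<times> real) set \<Rightarrow> 'a set \<Rightarrow> real \<Rightarrow> ('a \<times> real \<Rightarrow> real) set" where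
  "inner_signs A \<Omega> \<delta> = {s \<in> A \<rightarrow>\<^sub>E signs. region A \<delta> s \<subseteq> \<Omega>}"

definition cutoff :: "('a::euclidean_space \<times> real) set \<Rightarrow> 'a set \<Rightarrow> real \<Rightarrow> 'a \<Rightarrow> real" where
  "cutoff A \<Omega> \<delta> x = (\<Sum>s\<in>inner_signs A \<Omega> \<delta>. region_weight A \<delta> s x)"

lemma finite_inner_signs: "finite A \<Longrightarrow> finite (inner_signs A \<Omega> \<delta>)"
  unfolding inner_signs_def by (rule finite_subset[of _ "A \<rightarrow>\<^sub>E signs"]) (auto intro: finite_PiE)

lemma region_weight_range: "0 \<le> region_weight A \<delta> s x" "region_weight A \<delta> s x \<le> 1"
  unfolding region_weight_def by (auto intro: prod_nonneg prod_le_1 side_weight_range)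

lemma region_weight_support:
  assumes "finite A" "\<delta> > 0" "s \<in> A \<rightarrow>\<^sub>E signs" "region_weight A \<delta> s x \<noteq> 0"
  shows "x \<in> region A \<delta> s"
  unfolding region_def
proof (intro CollectI ballI)
  fix p assume p: "p \<in> A"
  then have "side_weight (s p) (level p x / \<delta>) \<noteq> 0" "s p \<in> signs"
    using assms by (auto simp: region_weight_def)
  from side_weight_support[OF this] \<open>\<delta> > 0\<close>
  show "(s p \<noteq> 0 \<longrightarrow> \<delta> \<le> s p * level p x) \<and> (s p = 0 \<longrightarrow> \<bar>level p x\<bar> \<le> 2 * \<delta>)"
    by (simp add: field_simps abs_le_iff)
qed

text \<open>Expand the product over the hyperplanes of the sums of the three side weights, each of which
  is \<open>1\<close>.\<close>

lemma region_weight_sum: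
  assumes "finite A"
  shows "(\<Sum>s\<in>A \<rightarrow>\<^sub>E signs. region_weight A \<delta> s x) = 1"
proof -
  have "(\<Prod>p\<in>A. \<Sum>\<sigma>\<in>signs. side_weight \<sigma> (level p x / \<delta>)) = (\<Sum>s\<in>A \<rightarrow>\<^sub>E signs. region_weight A \<delta> s x)"
    unfolding region_weight_def by (rule prod_sum_PiE) (use assms in auto)
  then show ?thesis by (simp only: side_weight_sum prod.neutral_const)
qed

lemma cutoff_range:
  assumes "finite A"
  shows "0 \<le> cutoff A \<Omega> \<delta> x" "cutoff A \<Omega> \<delta> x \<le> 1"
proof -
  show "0 \<le> cutoff A \<Omega> \<delta> x"
    unfolding cutoff_def by (intro sum_nonneg region_weight_range)
  have "cutoff A \<Omega> \<delta> x \<le> (\<Sum>s\<in>A \<rightarrow>\<^sub>E signs. region_weight A \<delta> s x)"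
    unfolding cutoff_def using assms
    by (intro sum_mono2) (auto simp: inner_signs_def region_weight_range intro: finite_PiE)
  then show "cutoff A \<Omega> \<delta> x \<le> 1" by (simp add: region_weight_sum assms)
qed

lemma smooth_cutoff: "smooth (cutoff A \<Omega> \<delta>)"
proof -
  have "smooth (\<lambda>x. side_weight \<sigma> (level p x / \<delta>))" for \<sigma> and p :: "'a \<times> real"
    using smooth_ridge[OF smooth_side_weight[of \<sigma>], of "fst p /\<^sub>R \<delta>" "snd p / \<delta>"]
    by (simp add: divide_inverse algebra_simps)
  then show ?thesis
    unfolding cutoff_def[abs_def] region_weight_def by (intro smooth_sum smooth_prod)
qed

lemma closed_region: "closed (region A \<delta> s)"
proof -
  have "region A \<delta> s = (\<Inter>p\<in>A. if s p = 0 then {x. \<bar>level p x\<bar> \<le> 2 * \<delta>} else {x. \<delta> \<le> s p * level p x})"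
    by (auto simp: region_def)
  moreover have "closed \<dots>"
    by (intro closed_INT ballI) (auto intro!: closed_Collect_le continuous_intros)
  ultimately show ?thesis by simp
qed

lemma test_function_cutoff:
  assumes "finite A" "\<delta> > 0" "bounded \<Omega>"
  shows "test_function \<Omega> (cutoff A \<Omega> \<delta>)"
  unfolding test_function_def
proof (intro conjI exI allI impI)
  let ?C = "\<Union>(region A \<delta> ` inner_signs A \<Omega> \<delta>)"
  show sub: "?C \<subseteq> \<Omega>" by (auto simp: inner_signs_def)
  have "closed ?C"
    using finite_inner_signs[OF assms(1)] closed_region by (intro closed_UN) auto
  with sub assms(3) show "compact ?C"
    using bounded_subset compact_eq_bounded_closed by blast
  show "smooth (cutoff A \<Omega> \<delta>)" by (rule smooth_cutoff)
  fix x assume x: "x \<notin> ?C"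
  have "region_weight A \<delta> s x = 0" if "s \<in> inner_signs A \<Omega> \<delta>" for s
    using region_weight_support[OF assms(1,2), of s x] that x by (auto simp: inner_signs_def)
  then show "cutoff A \<Omega> \<delta> x = 0" by (simp add: cutoff_def)
qed

lemma GDERIV_level: "GDERIV (\<lambda>x. level p x / \<delta>) x :> fst p /\<^sub>R \<delta>"
  unfolding gderiv_def
  by (auto intro!: derivative_eq_intros simp: inner_commute divide_inverse mult_ac)

lemma GDERIV_profile:
  assumes "\<And>\<tau>. \<exists>D. (f has_real_derivative D) (at \<tau>) \<and> \<bar>D\<bar> \<le> M" and "norm (fst p) = 1" "\<delta> > 0"
  shows "\<exists>c. GDERIV (\<lambda>x. f (level p x / \<delta>)) x :> c *\<^sub>R fst p \<and> \<bar>c\<bar> \<le> M / \<delta>"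
proof -
  obtain D where D: "(f has_real_derivative D) (at (level p x / \<delta>))" "\<bar>D\<bar> \<le> M"
    using assms(1) by blast
  have "GDERIV (\<lambda>x. f (level p x / \<delta>)) x :> D *\<^sub>R (fst p /\<^sub>R \<delta>)"
    by (rule GDERIV_DERIV_compose[OF GDERIV_level D(1)])
  then have "GDERIV (\<lambda>x. f (level p x / \<delta>)) x :> (D / \<delta>) *\<^sub>R fst p"
    by (simp only: scaleR_scaleR divide_inverse)
  moreover have "\<bar>D / \<delta>\<bar> \<le> M / \<delta>"
    using D(2) assms(3) by (simp add: divide_right_mono)
  ultimately show ?thesis by blast
qed

text \<open>By the product rule: each factor lies between \<open>0\<close> and \<open>1\<close> and has slope at most \<open>M / \<delta>\<close>.\<close>

lemma region_weight_gradient: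
  assumes "finite A" "\<And>p. p \<in> A \<Longrightarrow> norm (fst p) = 1" "\<delta> > 0" "M > 0"
    and M: "\<And>\<sigma> \<tau>. \<exists>D. (side_weight \<sigma> has_real_derivative D) (at \<tau>) \<and> \<bar>D\<bar> \<le> M"
  shows "\<exists>D. GDERIV (region_weight A \<delta> s) x :> D \<and> norm D \<le> real (card A) * (M / \<delta>)"
  using assms(1,2)
proof (induction A rule: finite_induct)
  case empty
  then show ?case
    by (intro exI[of _ 0]) (simp add: region_weight_def[abs_def] GDERIV_const)
next
  case (insert p A)
  obtain D where D: "GDERIV (region_weight A \<delta> s) x :> D" "norm D \<le> real (card A) * (M / \<delta>)"
    using insert by auto
  obtain c where c: "GDERIV (\<lambda>x. side_weight (s p) (level p x / \<delta>)) x :> c *\<^sub>R fst p" "\<bar>c\<bar> \<le> M / \<delta>"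
    using GDERIV_profile[OF M, of p \<delta> "s p" x] insert.prems assms(3) by auto
  let ?f = "side_weight (s p) (level p x / \<delta>)" and ?g = "region_weight A \<delta> s x"
  have "GDERIV (region_weight (insert p A) \<delta> s) x :> ?f *\<^sub>R D + ?g *\<^sub>R (c *\<^sub>R fst p)"
    using GDERIV_mult[OF c(1) D(1)] insert.hyps by (simp add: region_weight_def[abs_def])
  moreover have "norm (?f *\<^sub>R D + ?g *\<^sub>R (c *\<^sub>R fst p)) \<le> real (card (insert p A)) * (M / \<delta>)"
  proof -
    have "norm (?f *\<^sub>R D) \<le> 1 * norm D"
      using side_weight_range[of "s p" "level p x / \<delta>"] by (simp add: mult_left_le_one_le)
    moreover have "norm (?g *\<^sub>R (c *\<^sub>R fst p)) \<le> 1 * \<bar>c\<bar>"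
      using region_weight_range[of A \<delta> s x] insert.prems by (simp add: mult_left_le_one_le abs_mult)
    ultimately show ?thesis
      using norm_triangle_ineq[of "?f *\<^sub>R D" "?g *\<^sub>R (c *\<^sub>R fst p)"] D(2) c(2) insert.hyps
      by (simp add: algebra_simps)
  qed
  ultimately show ?case by blast
qed

lemma cutoff_gradient_bound:
  assumes "finite A" "\<And>p. p \<in> A \<Longrightarrow> norm (fst p) = 1"
  obtains G where "G > 0"
    "\<And>\<Omega> \<delta> x. \<delta> > 0 \<Longrightarrow> \<exists>D. GDERIV (cutoff A \<Omega> \<delta>) x :> D \<and> norm D \<le> G / \<delta>"
proof -
  obtain M where M: "M > 0" "\<And>\<sigma> \<tau>. \<exists>D. (side_weight \<sigma> has_real_derivative D) (at \<tau>) \<and> \<bar>D\<bar> \<le> M"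
    using side_weight_slope_bounded by blast
  let ?n = "real (card (A \<rightarrow>\<^sub>E signs))" and ?m = "real (card A)"
  define G where "G = ?n * (?m * M) + 1"
  have "G > 0" using M(1) by (simp add: G_def add_nonneg_pos)
  moreover have "\<exists>D. GDERIV (cutoff A \<Omega> \<delta>) x :> D \<and> norm D \<le> G / \<delta>" if \<delta>: "\<delta> > 0" for \<Omega> \<delta> x
  proof -
    have "\<forall>s. \<exists>D. GDERIV (region_weight A \<delta> s) x :> D \<and> norm D \<le> ?m * (M / \<delta>)"
      using region_weight_gradient[OF assms(1) _ \<delta> M] assms(2) by blast
    then obtain D where "\<forall>s. GDERIV (region_weight A \<delta> s) x :> D s \<and> norm (D s) \<le> ?m * (M / \<delta>)"
      by (rule choice[THEN exE])
    then have D: "\<And>s. GDERIV (region_weight A \<delta> s) x :> D s" "\<And>s. norm (D s) \<le> ?m * (M / \<delta>)"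
      by blast+
    have "GDERIV (cutoff A \<Omega> \<delta>) x :> (\<Sum>s\<in>inner_signs A \<Omega> \<delta>. D s)"
      unfolding cutoff_def[abs_def] by (intro GDERIV_sum D)
    moreover have "norm (\<Sum>s\<in>inner_signs A \<Omega> \<delta>. D s) \<le> G / \<delta>"
    proof -
      have "norm (\<Sum>s\<in>inner_signs A \<Omega> \<delta>. D s) \<le> real (card (inner_signs A \<Omega> \<delta>)) * (?m * (M / \<delta>))"
        by (rule sum_norm_bound) (rule D)
      also have "\<dots> \<le> ?n * (?m * (M / \<delta>))"
        using assms(1) M(1) \<delta>
        by (intro mult_right_mono of_nat_mono card_mono) (auto simp: inner_signs_def intro: finite_PiE)
      also have "\<dots> \<le> G / \<delta>"
        using \<delta> by (simp add: G_def add_divide_distrib)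
      finally show ?thesis .
    qed
    ultimately show ?thesis by blast
  qed
  ultimately show thesis using that by blast
qed

text \<open>For a point \<open>x\<close> at distance more than \<open>2 \<delta>\<close> from all hyperplanes in \<open>B\<close>, this is a neighbourhood
  of \<open>x\<close> on which the side weights of these hyperplanes are constant.\<close>

definition far_neighbourhood :: "('a::euclidean_space \<times> real) set \<Rightarrow> real \<Rightarrow> 'a \<Rightarrow> 'a set" where
  "far_neighbourhood B \<delta> x = {y. \<forall>q\<in>B. 2 * \<delta> < sgn (level q x) * level q y}"

lemma open_far_neighbourhood: "finite B \<Longrightarrow> open (far_neighbourhood B \<delta> x)"
proof -
  assume "finite B"
  moreover have "far_neighbourhood B \<delta> x = (\<Inter>q\<in>B. {y. 2 * \<delta> < sgn (level q x) * level q y})"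
    by (auto simp: far_neighbourhood_def)
  ultimately show ?thesis
    by (auto intro!: open_INT open_Collect_less continuous_intros)
qed

lemma far_neighbourhood_self: "(\<And>q. q \<in> B \<Longrightarrow> 2 * \<delta> < \<bar>level q x\<bar>) \<Longrightarrow> x \<in> far_neighbourhood B \<delta> x"
  by (simp add: far_neighbourhood_def abs_sgn mult.commute)

lemma far_neighbourhood_weight:
  assumes "y \<in> far_neighbourhood B \<delta> x" "\<delta> > 0" "q \<in> B" "\<sigma> \<in> signs"
  shows "side_weight \<sigma> (level q y / \<delta>) = (if \<sigma> = sgn (level q x) then 1 else 0)"
proof -
  have *: "2 * \<delta> < sgn (level q x) * level q y"
    using assms(1,3) by (simp add: far_neighbourhood_def)
  then have "sgn (level q y) = sgn (level q x)" "2 * \<delta> < \<bar>level q y\<bar>"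
    using assms(2) by (auto simp: sgn_if split: if_splits)
  moreover have "sgn (level q y / \<delta>) = sgn (level q y)" "\<bar>level q y / \<delta>\<bar> > 2"
    using assms(2) calculation(2) by (simp_all add: sgn_divide field_simps)
  ultimately show ?thesis
    using side_weight_far[of "level q y / \<delta>" \<sigma>] assms(4) by simp
qed

text \<open>The hyperplanes in \<open>B\<close> force the signs of every region that carries weight at \<open>y\<close> to agree on \<open>B\<close>
  with those of \<open>x\<close>. Such a region lies in the intersection of half-spaces assumed to be part of
  \<open>\<Omega>\<close>, so it is kept, and the kept weights add up to \<open>1\<close>.\<close>

lemma cutoff_eq_1:
  assumes A: "finite A" "\<delta> > 0" "B \<subseteq> A" and y: "y \<in> far_neighbourhood B \<delta> x"
    and sub: "{z. \<forall>q\<in>B. 0 < sgn (level q x) * level q z} \<subseteq> \<Omega>"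
  shows "cutoff A \<Omega> \<delta> y = 1"
proof -
  have "region A \<delta> s \<subseteq> \<Omega>" if s: "s \<in> A \<rightarrow>\<^sub>E signs" "region_weight A \<delta> s y \<noteq> 0" for s
  proof -
    have "s q = sgn (level q x) \<and> s q \<noteq> 0" if q: "q \<in> B" for q
    proof -
      have "side_weight (s q) (level q y / \<delta>) \<noteq> 0" "s q \<in> signs"
        using s A(1,3) q by (auto simp: region_weight_def)
      then have "s q = sgn (level q x)"
        using far_neighbourhood_weight[OF y A(2) q] by (metis (full_types))
      moreover have "sgn (level q x) \<noteq> 0"
        using y q A(2) by (auto simp: far_neighbourhood_def)
      ultimately show ?thesis by simp
    qed
    then have "region A \<delta> s \<subseteq> {z. \<forall>q\<in>B. 0 < sgn (level q x) * level q z}"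
      using A(2,3) by (fastforce simp: region_def)
    with sub show ?thesis by blast
  qed
  then have "cutoff A \<Omega> \<delta> y = (\<Sum>s\<in>A \<rightarrow>\<^sub>E signs. region_weight A \<delta> s y)"
    unfolding cutoff_def using A(1)
    by (intro sum.mono_neutral_left) (auto simp: inner_signs_def intro: finite_PiE)
  then show ?thesis by (simp add: region_weight_sum A(1))
qed

text \<open>Near \<open>x\<close> the weights of all other hyperplanes are constant, so the cutoff is a function of the
  signed distance from \<open>hyperplane p\<close> alone.\<close>

lemma cutoff_gradient_parallel:
  assumes A: "finite A" "\<delta> > 0" "p \<in> A" "norm (fst p) = 1"
    and far: "\<And>q. q \<in> A \<Longrightarrow> q \<noteq> p \<Longrightarrow> 2 * \<delta> < \<bar>level q x\<bar>"
  shows "\<exists>c. GDERIV (cutoff A \<Omega> \<delta>) x :> c *\<^sub>R fst p"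
proof -
  obtain M where M: "\<And>\<sigma> \<tau>. \<exists>D. (side_weight \<sigma> has_real_derivative D) (at \<tau>) \<and> \<bar>D\<bar> \<le> M"
    using side_weight_slope_bounded by blast
  define U where "U = far_neighbourhood (A - {p}) \<delta> x"
  define e where "e s = (\<Prod>q\<in>A - {p}. if s q = sgn (level q x) then 1 else 0 :: real)" for s
  have U: "open U" "x \<in> U"
    unfolding U_def using A(1) far
    by (simp add: open_far_neighbourhood, intro far_neighbourhood_self) simp
  have w: "region_weight A \<delta> s y = e s * side_weight (s p) (level p y / \<delta>)"
    if "s \<in> inner_signs A \<Omega> \<delta>" "y \<in> U" for s y
  proof -
    have "(\<Prod>q\<in>A - {p}. side_weight (s q) (level q y / \<delta>)) = e s"
      unfolding e_def using that A(2)
      by (intro prod.cong refl far_neighbourhood_weight[of _ "A - {p}"]) (auto simp: U_def inner_signs_def)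
    then show ?thesis
      unfolding region_weight_def
      by (simp only: prod.remove[OF A(1,3)] mult.commute[of "side_weight (s p) _"])
  qed
  have "\<forall>s. \<exists>c. GDERIV (\<lambda>y. side_weight (s p) (level p y / \<delta>)) x :> c *\<^sub>R fst p"
    using GDERIV_profile[OF M A(4,2)] by blast
  then obtain c where "\<forall>s. GDERIV (\<lambda>y. side_weight (s p) (level p y / \<delta>)) x :> c s *\<^sub>R fst p"
    by (rule choice[THEN exE])
  then have c: "GDERIV (\<lambda>y. side_weight (s p) (level p y / \<delta>)) x :> c s *\<^sub>R fst p" for s
    by blast
  have "GDERIV (\<lambda>y. e s * side_weight (s p) (level p y / \<delta>)) x :> (e s * c s) *\<^sub>R fst p" for s
    using GDERIV_mult[OF GDERIV_const[of "e s"] c[of s]] by simp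
  then have "GDERIV (\<lambda>y. \<Sum>s\<in>inner_signs A \<Omega> \<delta>. e s * side_weight (s p) (level p y / \<delta>)) x
      :> (\<Sum>s\<in>inner_signs A \<Omega> \<delta>. (e s * c s) *\<^sub>R fst p)"
    by (intro GDERIV_sum)
  then have "GDERIV (cutoff A \<Omega> \<delta>) x :> (\<Sum>s\<in>inner_signs A \<Omega> \<delta>. (e s * c s) *\<^sub>R fst p)"
    by (rule GDERIV_cong_open[OF _ U]) (simp add: cutoff_def w cong: sum.cong)
  then show ?thesis unfolding scaleR_sum_left[symmetric] by blast
qed

lemma cutoff_gradient_far:
  assumes A: "finite A" "\<delta> > 0" and far: "\<And>q. q \<in> A \<Longrightarrow> 2 * \<delta> < \<bar>level q x\<bar>"
  shows "GDERIV (cutoff A \<Omega> \<delta>) x :> 0"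
proof (rule GDERIV_cong_open[OF GDERIV_const])
  show "open (far_neighbourhood A \<delta> x)" "x \<in> far_neighbourhood A \<delta> x"
    using A(1) far by (simp add: open_far_neighbourhood, intro far_neighbourhood_self) simp
  then have x: "x \<in> far_neighbourhood A \<delta> x" by simp
  fix y assume y: "y \<in> far_neighbourhood A \<delta> x"
  have "region_weight A \<delta> s y = region_weight A \<delta> s x" if "s \<in> inner_signs A \<Omega> \<delta>" for s
    unfolding region_weight_def
  proof (rule prod.cong[OF refl])
    fix q assume q: "q \<in> A"
    then have "s q \<in> signs" using that by (auto simp: inner_signs_def)
    then show "side_weight (s q) (level q y / \<delta>) = side_weight (s q) (level q x / \<delta>)"
      using far_neighbourhood_weight[OF y A(2) q] far_neighbourhood_weight[OF x A(2) q] by metis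
  qed
  then show "cutoff A \<Omega> \<delta> y = cutoff A \<Omega> \<delta> x" by (simp add: cutoff_def)
qed

section \<open>Cells, facets and the hyperplanes they span\<close>

lemma unit_hyperplanes_eq:
  fixes a c :: "'a::euclidean_space"
  assumes "norm a = 1" "norm c = 1" and eq: "{x. a \<bullet> x = b} = {x. c \<bullet> x = d}"
  shows "c = a \<and> d = b \<or> c = - a \<and> d = - b"
proof -
  have aa: "a \<bullet> a = 1" using assms(1) by (simp add: dot_square_norm)
  have "b *\<^sub>R a \<in> {x. a \<bullet> x = b}" by (simp add: aa)
  then have d: "c \<bullet> (b *\<^sub>R a) = d" using eq by blast
  have "c = a \<or> c = - a"
  proof (rule ccontr)
    assume "\<not> ?thesis"
    then obtain w where w: "a \<bullet> w = 0" "c \<bullet> w = 1"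
      using transversal_direction[OF assms(1,2)] by metis
    have "b *\<^sub>R a + w \<in> {x. a \<bullet> x = b}" by (simp add: aa inner_add_right w)
    then have "c \<bullet> (b *\<^sub>R a + w) = d" using eq by blast
    with d w show False by (simp add: inner_add_right)
  qed
  with d aa show ?thesis by auto
qed

text \<open>A Lipschitz domain lies locally on one side of its boundary: just below the graph there are
  exterior points. This rules out slits, along which the closure would have more interior points.\<close>

lemma lipschitz_domain_interior_closure:
  assumes "lipschitz_domain \<Omega>"
  shows "interior (closure \<Omega>) = \<Omega>"
proof
  have "open \<Omega>" using assms by (simp add: lipschitz_domain_def)
  then show "\<Omega> \<subseteq> interior (closure \<Omega>)"
    by (simp add: closure_subset interior_maximal)
  show "interior (closure \<Omega>) \<subseteq> \<Omega>"
  proof (rule ccontr)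
    assume "\<not> ?thesis"
    then obtain x where x: "x \<in> interior (closure \<Omega>)" "x \<notin> \<Omega>" by blast
    then have "x \<in> frontier \<Omega>"
      using \<open>open \<Omega>\<close> interior_subset by (auto simp: frontier_def interior_open)
    then obtain r e C g where r: "r > 0" and e: "norm e = 1" and g: "C-lipschitz_on UNIV g"
      and epi: "\<And>y. y \<in> ball x r \<Longrightarrow> y \<in> \<Omega> \<longleftrightarrow> g (y - (y \<bullet> e) *\<^sub>R e) < y \<bullet> e"
      using assms unfolding lipschitz_domain_def by meson
    have ee: "e \<bullet> e = 1" using e by (simp add: dot_square_norm)
    obtain s where s: "s > 0" "ball x s \<subseteq> closure \<Omega>"
      using x(1) by (meson mem_interior)
    define t where "t = min r s / 2"
    define z where "z = x - t *\<^sub>R e"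
    have t: "0 < t" "t < r" "t < s" using r s(1) by (auto simp: t_def)
    have z: "z \<in> ball x r" "z \<in> closure \<Omega>"
      using t s(2) e by (auto simp: z_def dist_norm)
    have "z - (z \<bullet> e) *\<^sub>R e = x - (x \<bullet> e) *\<^sub>R e"
      by (simp add: z_def inner_diff_left ee algebra_simps)
    moreover have "x \<bullet> e \<le> g (x - (x \<bullet> e) *\<^sub>R e)"
      using epi[of x] x(2) r by auto
    moreover have "z \<bullet> e < x \<bullet> e"
      using t by (simp add: z_def inner_diff_left ee)
    ultimately have below: "z \<bullet> e < g (z - (z \<bullet> e) *\<^sub>R e)"
      by simp
    have cont: "continuous_on UNIV g"
      using g by (rule lipschitz_on_continuous_on)
    have "open (ball x r \<inter> {y. y \<bullet> e < g (y - (y \<bullet> e) *\<^sub>R e)})"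
      by (intro open_Int open_ball open_Collect_less continuous_intros
          continuous_on_compose2[OF cont]) auto
    moreover have "(ball x r \<inter> {y. y \<bullet> e < g (y - (y \<bullet> e) *\<^sub>R e)}) \<inter> \<Omega> = {}"
      using epi by force
    ultimately have "(ball x r \<inter> {y. y \<bullet> e < g (y - (y \<bullet> e) *\<^sub>R e)}) \<inter> closure \<Omega> = {}"
      using open_Int_closure_eq_empty by blast
    with below z show False by blast
  qed
qed

locale polytopal_mesh =
  fixes \<Omega> :: "'a::euclidean_space set" and \<T> :: "'a set set"
  assumes domain: "lipschitz_domain \<Omega>" and mesh: "fe_mesh \<Omega> \<T>"
begin

lemma open_domain: "open \<Omega>" and bounded_domain: "bounded \<Omega>"
  using domain by (auto simp: lipschitz_domain_def)

lemma Union_cells: "\<Union>\<T> = closure \<Omega>" and finite_cells: "finite \<T>"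
  using mesh by (auto simp: fe_mesh_def)

lemma cell:
  assumes "K \<in> \<T>"
  shows "polytope K" "convex K" "closed K" "interior K \<noteq> {}" "K \<subseteq> closure \<Omega>"
    "interior K \<subseteq> \<Omega>" "closure (interior K) = K" "aff_dim K = DIM('a)"
proof -
  show p: "polytope K" and i: "interior K \<noteq> {}"
    using assms mesh by (auto simp: fe_mesh_def)
  show c: "convex K" "closed K"
    using p polytope_imp_convex polytope_imp_closed by auto
  show s: "K \<subseteq> closure \<Omega>" using Union_cells assms by blast
  show "interior K \<subseteq> \<Omega>"
    using interior_mono[OF s] lipschitz_domain_interior_closure[OF domain] by simp
  show "closure (interior K) = K"
    using convex_closure_interior[OF c(1) i] c(2) by simp
  show "aff_dim K = DIM('a)" using i aff_dim_nonempty_interior by blast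
qed

lemma cell_frontier: "K \<in> \<T> \<Longrightarrow> frontier K = \<Union>{F. F facet_of K}"
  using cell(1,4)[of K] rel_frontier_of_polyhedron[of K] polytope_imp_polyhedron[of K]
  by (simp add: rel_frontier_def frontier_def rel_interior_nonempty_interior)

text \<open>A facet of a full-dimensional cell has codimension one, so its affine hull fills the supporting
  hyperplane. The normal is scaled to length one.\<close>

lemma facet_hyperplane:
  assumes "K \<in> \<T>" "F facet_of K"
  obtains a b where "norm a = 1" "K \<subseteq> {x. a \<bullet> x \<le> b}" "F = K \<inter> {x. a \<bullet> x = b}"
    "affine hull F = {x. a \<bullet> x = b}"
proof -
  obtain a b where ab: "a \<noteq> 0" "K \<subseteq> {x. a \<bullet> x \<le> b}" "F = K \<inter> {x. a \<bullet> x = b}"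
    using facet_of_polyhedron[OF polytope_imp_polyhedron[OF cell(1)[OF assms(1)]] assms(2)] .
  have F: "F \<noteq> {}" "aff_dim F = DIM('a) - 1"
    using assms(2) cell(8)[OF assms(1)] by (auto simp: facet_of_def)
  have h: "{x. (a /\<^sub>R norm a) \<bullet> x = b / norm a} = {x. a \<bullet> x = b}"
    "{x. (a /\<^sub>R norm a) \<bullet> x \<le> b / norm a} = {x. a \<bullet> x \<le> b}"
    using ab(1) by (auto simp: field_simps)
  have "affine hull F = {x. a \<bullet> x = b}"
  proof (rule affine_dim_equal)
    show "affine hull F \<subseteq> {x. a \<bullet> x = b}"
      using ab(3) by (intro hull_minimal affine_hyperplane) auto
  qed (use F ab(1) in \<open>auto simp: affine_hyperplane\<close>)
  then show thesis
    using that[of "a /\<^sub>R norm a" "b / norm a"] ab h by simp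
qed

lemma facet_eq_Int_affine_hull: "K \<in> \<T> \<Longrightarrow> F facet_of K \<Longrightarrow> F = K \<inter> affine hull F"
  using facet_hyperplane by metis

text \<open>Two distinct cells meet in a common face, but a face that meets the interior of a polytope is the
  whole polytope.\<close>

lemma cells_disjoint_interiors:
  assumes "K \<in> \<T>" "L \<in> \<T>" "interior K \<inter> interior L \<noteq> {}"
  shows "K = L"
proof (rule ccontr)
  assume "K \<noteq> L"
  then have f: "(K \<inter> L) face_of K" "(K \<inter> L) face_of L"
    using mesh assms by (auto simp: fe_mesh_def)
  have "(K \<inter> L) \<inter> interior K \<noteq> {}" "(K \<inter> L) \<inter> interior L \<noteq> {}"
    using assms(3) interior_subset by fastforce+
  then have "K \<inter> L = K" "K \<inter> L = L"
    using face_of_disjoint_interior f by blast+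
  with \<open>K \<noteq> L\<close> show False by simp
qed

text \<open>The description of \<open>F\<close> as a contact set determines the hyperplane, hence the unit normal up to
  sign; the opposite sign would put \<open>K\<close> inside the hyperplane.\<close>

lemma outer_normal_eq:
  assumes K: "K \<in> \<T>" and F: "F facet_of K"
    and ab: "norm a = 1" "K \<subseteq> {x. a \<bullet> x \<le> b}" "affine hull F = {x. a \<bullet> x = b}"
  shows "outer_normal K F = a"
  unfolding outer_normal_def
proof (rule the_equality)
  have Fab: "F = K \<inter> {x. a \<bullet> x = b}"
    using facet_eq_Int_affine_hull[OF K F] ab(3) by simp
  show "norm a = 1 \<and> (\<exists>b. K \<subseteq> {x. a \<bullet> x \<le> b} \<and> F = K \<inter> {x. a \<bullet> x = b})"
    using ab Fab by blast
  fix n assume "norm n = 1 \<and> (\<exists>b. K \<subseteq> {x. n \<bullet> x \<le> b} \<and> F = K \<inter> {x. n \<bullet> x = b})"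
  then obtain c where n: "norm n = 1" "K \<subseteq> {x. n \<bullet> x \<le> c}" "F = K \<inter> {x. n \<bullet> x = c}" by blast
  have "n \<noteq> 0" "a \<noteq> 0" using n(1) ab(1) by auto
  have "affine hull F = {x. n \<bullet> x = c}"
  proof (rule affine_dim_equal)
    show "affine hull F \<subseteq> {x. n \<bullet> x = c}"
      using n(3) by (intro hull_minimal affine_hyperplane) auto
  qed (use F \<open>n \<noteq> 0\<close> \<open>a \<noteq> 0\<close> ab(3) in \<open>auto simp: affine_hyperplane facet_of_def\<close>)
  then have "n = a \<and> c = b \<or> n = - a \<and> c = - b"
    using unit_hyperplanes_eq[OF ab(1) n(1)] ab(3) by simp
  moreover have "\<not> (n = - a \<and> c = - b)"
  proof
    assume "n = - a \<and> c = - b"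
    then have "K \<subseteq> {x. a \<bullet> x = b}" using n(2) ab(2) by force
    then have "interior K \<subseteq> interior {x. a \<bullet> x = b}" by (rule interior_mono)
    then show False
      using cell(4)[OF K] \<open>a \<noteq> 0\<close> by (simp add: interior_hyperplane)
  qed
  ultimately show "n = a" by blast
qed

text \<open>A point \<open>z\<close> near \<open>y\<close> on the inner side lies on a segment from a fixed interior point \<open>k\<close> of \<open>K\<close>
  to a point \<open>m z\<close> of the hyperplane. This point depends continuously on \<open>z\<close> and equals \<open>y\<close> for
  \<open>z = y\<close>, so it remains in the facet.\<close>

lemma half_ball_in_cell:
  assumes K: "K \<in> \<T>" and F: "F facet_of K" and y: "y \<in> rel_interior F"
    and ab: "norm a = 1" "K \<subseteq> {x. a \<bullet> x \<le> b}" "affine hull F = {x. a \<bullet> x = b}"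
  obtains r where "r > 0" "ball y r \<inter> {x. a \<bullet> x < b} \<subseteq> interior K" "ball y r \<inter> {x. a \<bullet> x \<le> b} \<subseteq> K"
proof -
  obtain k where k: "k \<in> interior K" using cell(4)[OF K] by blast
  have "a \<noteq> 0" using ab(1) by auto
  have ak: "a \<bullet> k < b"
    using k interior_mono[OF ab(2)] \<open>a \<noteq> 0\<close> by (auto simp: interior_halfspace_le)
  obtain e where e: "e > 0" "ball y e \<inter> affine hull F \<subseteq> F" and yF: "y \<in> F"
    using y by (auto simp: mem_rel_interior_ball)
  have ay: "a \<bullet> y = b" using yF hull_subset[of F affine] ab(3) by blast
  have FK: "F \<subseteq> K" using F facet_of_imp_subset by blast
  define l where "l z = (b - a \<bullet> z) / (b - a \<bullet> k)" for z
  define m where "m z = (z - l z *\<^sub>R k) /\<^sub>R (1 - l z)" for z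
  have ly: "l y = 0" by (simp add: l_def ay)
  have "isCont l y"
    unfolding l_def using ak by (intro continuous_intros) auto
  then have "isCont m y" "isCont l y"
    unfolding m_def using ly by (auto intro!: continuous_intros)
  moreover have "m y = y" by (simp add: m_def ly)
  ultimately have "\<forall>\<^sub>F z in at y. dist (m z) y < e" "\<forall>\<^sub>F z in at y. l z < 1"
    using e(1) ly by (auto simp: isCont_def intro: tendstoD order_tendstoD)
  then have "\<forall>\<^sub>F z in at y. dist (m z) y < e \<and> l z < 1"
    by (rule eventually_conj)
  then obtain r where r: "r > 0" "\<And>z. z \<noteq> y \<Longrightarrow> dist z y < r \<Longrightarrow> dist (m z) y < e \<and> l z < 1"
    by (auto simp: eventually_at)
  have m: "m z \<in> F" "l z < 1" if "z \<in> ball y (min r e)" for z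
  proof -
    have *: "dist (m z) y < e" "l z < 1"
      using r(2)[of z] that \<open>m y = y\<close> ly e(1) by (cases "z = y"; auto simp: dist_commute)+
    have "l z * (b - a \<bullet> k) = b - a \<bullet> z" using ak by (simp add: l_def)
    then have "a \<bullet> z - l z * (a \<bullet> k) = b * (1 - l z)" by (simp add: algebra_simps)
    then have "a \<bullet> m z = b"
      using *(2) by (simp add: m_def inner_diff_right)
    with * e(2) show "m z \<in> F" "l z < 1" by (auto simp: ab(3) dist_commute)
  qed
  have i: "z \<in> interior K" if "z \<in> ball y (min r e)" "a \<bullet> z < b" for z
  proof -
    have "0 < l z" "l z \<le> 1" using m(2)[OF that(1)] that(2) ak by (auto simp: l_def)
    moreover have "m z \<in> K" using m(1)[OF that(1)] FK by blast
    ultimately have "m z - l z *\<^sub>R (m z - k) \<in> interior K"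
      using mem_interior_convex_shrink[OF cell(2)[OF K] k] by blast
    moreover have "m z - l z *\<^sub>R (m z - k) = (1 - l z) *\<^sub>R m z + l z *\<^sub>R k"
      by (simp add: algebra_simps)
    moreover have "(1 - l z) *\<^sub>R m z = z - l z *\<^sub>R k"
      using m(2)[OF that(1)] by (simp add: m_def)
    ultimately show ?thesis by simp
  qed
  have "z \<in> K" if "z \<in> ball y (min r e)" "a \<bullet> z \<le> b" for z
  proof (cases "a \<bullet> z < b")
    case True
    with i that interior_subset show ?thesis by blast
  next
    case False
    with that e(2) FK show ?thesis by (auto simp: ab(3))
  qed
  with i show thesis
    by (intro that[of "min r e"]) (use r(1) e(1) in auto)
qed

text \<open>On the same side of their common facet, both cells would contain the same half-ball.\<close>

lemma cells_on_opposite_sides: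
  assumes K: "K \<in> \<T>" "F facet_of K" and L: "L \<in> \<T>" "F facet_of L" and "K \<noteq> L"
    and ab: "norm a = 1" "K \<subseteq> {x. a \<bullet> x \<le> b}" "affine hull F = {x. a \<bullet> x = b}"
  shows "L \<subseteq> {x. (- a) \<bullet> x \<le> - b}"
proof -
  obtain c d where cd: "norm c = 1" "L \<subseteq> {x. c \<bullet> x \<le> d}" "affine hull F = {x. c \<bullet> x = d}"
    using facet_hyperplane[OF L] by metis
  have "c = a \<and> d = b \<or> c = - a \<and> d = - b"
    using unit_hyperplanes_eq[OF ab(1) cd(1)] ab(3) cd(3) by simp
  moreover have "\<not> (c = a \<and> d = b)"
  proof
    assume "c = a \<and> d = b"
    with cd have Lab: "L \<subseteq> {x. a \<bullet> x \<le> b}" by simp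
    have "F \<noteq> {}" "convex F"
      using K facet_of_imp_face_of face_of_imp_convex by (auto simp: facet_of_def)
    then obtain y where y: "y \<in> rel_interior F"
      using rel_interior_eq_empty by blast
    obtain r where r: "r > 0" "ball y r \<inter> {x. a \<bullet> x < b} \<subseteq> interior K"
      using half_ball_in_cell[OF K y ab] by metis
    obtain s where s: "s > 0" "ball y s \<inter> {x. a \<bullet> x < b} \<subseteq> interior L"
      using half_ball_in_cell[OF L y ab(1) Lab ab(3)] by metis
    have "y \<in> affine hull F"
      using subsetD[OF rel_interior_subset y] by (rule hull_inc)
    then have ay: "a \<bullet> y = b" using ab(3) by blast
    define t where "t = min r s / 2"
    have "t > 0" "t < r" "t < s" using r(1) s(1) by (auto simp: t_def)
    then have "y - t *\<^sub>R a \<in> ball y r \<inter> {x. a \<bullet> x < b}" "y - t *\<^sub>R a \<in> ball y s \<inter> {x. a \<bullet> x < b}"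
      using ab(1) by (auto simp: dist_norm inner_diff_right ay dot_square_norm)
    with r s have "interior K \<inter> interior L \<noteq> {}" by blast
    with cells_disjoint_interiors K L \<open>K \<noteq> L\<close> show False by blast
  qed
  ultimately show ?thesis using cd(2) by blast
qed

lemma outer_normals_opposite:
  assumes K: "K \<in> \<T>" "F facet_of K" and L: "L \<in> \<T>" "F facet_of L" and "K \<noteq> L"
  shows "outer_normal L F = - outer_normal K F"
proof -
  obtain a b where ab: "norm a = 1" "K \<subseteq> {x. a \<bullet> x \<le> b}" "affine hull F = {x. a \<bullet> x = b}"
    using facet_hyperplane[OF K] by metis
  have "outer_normal K F = a"
    using outer_normal_eq[OF K ab] .
  moreover have "outer_normal L F = - a"
    using outer_normal_eq[OF L, of "- a" "- b"] cells_on_opposite_sides[OF K L \<open>K \<noteq> L\<close> ab] ab by simp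
  ultimately show ?thesis by simp
qed

text \<open>If some point of \<open>F\<close> were interior to \<open>\<Omega>\<close>, then so would be a relatively interior point \<open>z\<close>. A second
  cell would touch \<open>z\<close> and, by conformity of the mesh, have the whole of \<open>F\<close> as a facet. The
  half-balls of both cells would then surround \<open>y\<close>.\<close>

lemma facet_in_frontier:
  assumes K: "K \<in> \<T>" and F: "F facet_of K" and y: "y \<in> rel_interior F" "y \<in> frontier \<Omega>"
  shows "F \<subseteq> frontier \<Omega>"
proof (rule ccontr)
  assume "\<not> ?thesis"
  have FK: "F \<subseteq> K" "F face_of K" "convex F"
    using facet_of_imp_subset[OF F] facet_of_imp_face_of[OF F]
      face_of_imp_convex[OF facet_of_imp_face_of[OF F]] by simp_all
  obtain a b where ab: "norm a = 1" "K \<subseteq> {x. a \<bullet> x \<le> b}" "affine hull F = {x. a \<bullet> x = b}"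
    using facet_hyperplane[OF K F] by metis
  from \<open>\<not> ?thesis\<close> obtain z' where "z' \<in> F" "z' \<in> \<Omega>"
    using FK(1) cell(5)[OF K] open_domain by (auto simp: frontier_def interior_open)
  moreover have "F \<subseteq> closure (rel_interior F)"
    using convex_closure_rel_interior[OF FK(3)] closure_subset by blast
  ultimately obtain z where z: "z \<in> rel_interior F" "z \<in> \<Omega>"
    using open_domain open_Int_closure_eq_empty[of \<Omega> "rel_interior F"] by blast
  have zF: "z \<in> F" using z(1) rel_interior_subset by blast
  have "z \<in> \<Union>(\<T> - {K})"
  proof (rule ccontr)
    assume n: "z \<notin> \<Union>(\<T> - {K})"
    have "closed (\<Union>(\<T> - {K}))"
      using finite_cells cell(3) by (intro closed_Union) auto
    then have "open (\<Omega> - \<Union>(\<T> - {K}))"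
      using open_domain by (rule open_Diff[rotated])
    moreover have "\<Omega> - \<Union>(\<T> - {K}) \<subseteq> K"
      using Union_cells closure_subset[of \<Omega>] by blast
    ultimately have "z \<in> interior K"
      using n z(2) interior_maximal by blast
    moreover have "interior K \<subseteq> {x. a \<bullet> x < b}"
    proof -
      have "a \<noteq> 0" using ab(1) by auto
      then show ?thesis using interior_mono[OF ab(2)] by (simp add: interior_halfspace_le)
    qed
    moreover have "a \<bullet> z = b" using zF ab(3) hull_subset[of F affine] by blast
    ultimately show False by auto
  qed
  then obtain M where M: "M \<in> \<T>" "M \<noteq> K" "z \<in> M" by blast
  have faces: "(M \<inter> K) face_of M" "(M \<inter> K) face_of K"
    using mesh M K by (auto simp: fe_mesh_def)
  have "F \<subseteq> M \<inter> K"
    using z(1) zF M(3) FK by (intro subset_of_face_of[OF faces(2)]) auto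
  then have "F face_of M"
    using face_of_subset[OF FK(2)] faces(1) face_of_trans by blast
  then have FM: "F facet_of M"
    using F cell(8)[OF M(1)] cell(8)[OF K] by (auto simp: facet_of_def)
  obtain r where r: "r > 0" "ball y r \<inter> {x. a \<bullet> x \<le> b} \<subseteq> K"
    using half_ball_in_cell[OF K F y(1) ab] by metis
  have "M \<subseteq> {x. (- a) \<bullet> x \<le> - b}"
    using cells_on_opposite_sides[OF K F M(1) FM _ ab] M(2) by blast
  moreover have "norm (- a) = 1" "affine hull F = {x. (- a) \<bullet> x = - b}"
    using ab by simp_all
  ultimately obtain s where s: "s > 0" "ball y s \<inter> {x. (- a) \<bullet> x \<le> - b} \<subseteq> M"
    using half_ball_in_cell[OF M(1) FM y(1), of "- a" "- b"] by blast
  have "ball y (min r s) \<subseteq> K \<union> M"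
  proof
    fix x assume "x \<in> ball y (min r s)"
    then show "x \<in> K \<union> M"
      using r(2) s(2) by (cases "a \<bullet> x \<le> b") auto
  qed
  then have "ball y (min r s) \<subseteq> closure \<Omega>"
    using cell(5) K M(1) by blast
  then have "y \<in> interior (closure \<Omega>)"
    using r(1) s(1) by (auto simp: mem_interior intro!: exI[of _ "min r s"])
  then have "y \<in> \<Omega>" using lipschitz_domain_interior_closure[OF domain] by simp
  with y(2) open_domain show False by (simp add: frontier_def interior_open)
qed

text \<open>The hyperplanes spanned by the facets, each with one choice of a unit normal and an offset.
  Choosing for hyperplanes instead of facets ensures that the two cells at an interior facet do not
  contribute the same hyperplane twice, with opposite normals.\<close>

definition arrangement :: "('a \<times> real) set" where
  "arrangement = (\<lambda>H. SOME p. norm (fst p) = 1 \<and> hyperplane p = H) `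
     (\<Union>K\<in>\<T>. (\<lambda>F. affine hull F) ` {F. F facet_of K})"

lemma finite_arrangement: "finite arrangement"
  unfolding arrangement_def
  using finite_cells cell(1) finite_polytope_facets by (intro finite_imageI finite_UN_I) auto

lemma arrangement_Some:
  assumes "K \<in> \<T>" "F facet_of K"
  defines "p \<equiv> SOME p. norm (fst p) = 1 \<and> hyperplane p = affine hull F"
  shows "norm (fst p) = 1 \<and> hyperplane p = affine hull F"
proof -
  obtain a b where "norm a = 1" "affine hull F = {x. a \<bullet> x = b}"
    using facet_hyperplane[OF assms(1,2)] by metis
  then have "norm (fst (a, b)) = 1 \<and> hyperplane (a, b) = affine hull F" by simp
  then show ?thesis unfolding p_def by (rule someI)
qed

lemma arrangement_unit: "p \<in> arrangement \<Longrightarrow> norm (fst p) = 1"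
  using arrangement_Some by (auto simp: arrangement_def)

lemma arrangement_distinct:
  assumes "p \<in> arrangement" "q \<in> arrangement" "p \<noteq> q"
  shows "hyperplane p \<noteq> hyperplane q"
proof
  assume eq: "hyperplane p = hyperplane q"
  obtain K F L G where "K \<in> \<T>" "F facet_of K" "L \<in> \<T>" "G facet_of L"
    and pq: "p = (SOME p. norm (fst p) = 1 \<and> hyperplane p = affine hull F)"
      "q = (SOME p. norm (fst p) = 1 \<and> hyperplane p = affine hull G)"
    using assms(1,2) by (auto simp: arrangement_def)
  then have "affine hull F = affine hull G"
    using arrangement_Some[of K F] arrangement_Some[of L G] eq by auto
  with pq assms(3) show False by simp
qed

lemma facet_in_arrangement:
  assumes "K \<in> \<T>" "F facet_of K"
  obtains p where "p \<in> arrangement" "hyperplane p = affine hull F"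
  using arrangement_Some[OF assms] assms that unfolding arrangement_def by blast

lemma cell_frontier_arrangement:
  assumes "K \<in> \<T>" "x \<in> frontier K"
  obtains F p where "F facet_of K" "x \<in> F" "p \<in> arrangement" "hyperplane p = affine hull F"
    "x \<in> hyperplane p"
proof -
  obtain F where F: "F facet_of K" "x \<in> F" using cell_frontier assms by blast
  then show thesis
    using facet_in_arrangement[OF assms(1)] that by (metis hull_inc)
qed

text \<open>The frontier of a cell is covered by the arrangement, so a connected set that avoids the
  arrangement cannot leave a cell.\<close>

lemma chamber_in_cell:
  assumes "M \<in> \<T>" "convex C" "C \<inter> M \<noteq> {}" and off: "\<And>p. p \<in> arrangement \<Longrightarrow> C \<inter> hyperplane p = {}"
  shows "C \<subseteq> interior M"
proof -
  have "x \<notin> frontier M" if "x \<in> C" for x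
  proof
    assume "x \<in> frontier M"
    then obtain p where "p \<in> arrangement" "x \<in> hyperplane p"
      by (rule cell_frontier_arrangement[OF assms(1)])
    with off that show False by blast
  qed
  then have "C \<inter> frontier M = {}" by blast
  moreover from this have "C \<subseteq> M"
    using connected_Int_frontier[OF convex_connected[OF assms(2)] assms(3)] by blast
  ultimately show ?thesis
    using cell(3)[OF assms(1)] by (auto simp: frontier_def)
qed

text \<open>Only \<open>hyperplane p\<close> cuts \<open>Q\<close>, into one half \<open>C\<close> inside \<open>K\<close> and another half \<open>D\<close>. If \<open>D\<close> met a
  cell it would be contained in it, and then all of \<open>Q\<close> would be in the interior of the closure of
  \<open>\<Omega>\<close>, which is \<open>\<Omega>\<close>. So \<open>D\<close> is exterior, and the wall between the halves is part of a
  boundary facet of \<open>K\<close>.\<close>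

lemma crossing_wall:
  assumes p: "p \<in> arrangement" and Q: "open Q" "convex Q"
    and off: "\<And>q. q \<in> arrangement \<Longrightarrow> q \<noteq> p \<Longrightarrow> Q \<inter> hyperplane q = {}"
    and K: "K \<in> \<T>" and x: "x \<in> Q" "x \<in> interior K" "x \<notin> hyperplane p"
    and y: "y \<in> Q" "y \<in> hyperplane p" and not: "\<not> Q \<subseteq> \<Omega>"
  obtains F where "F facet_of K" "F \<subseteq> frontier \<Omega>" "affine hull F = hyperplane p" "y \<in> rel_interior F"
proof -
  define s where "s = (if fst p \<bullet> x < snd p then 1 else - 1 :: real)"
  define a where "a = s *\<^sub>R fst p"
  define b where "b = s * snd p"
  have ax: "a \<bullet> x < b" using x(3) by (auto simp: a_def b_def s_def)
  have hp: "hyperplane p = {z. a \<bullet> z = b}" by (auto simp: a_def b_def s_def)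
  have "norm a = 1" using arrangement_unit[OF p] by (auto simp: a_def s_def)
  then have aa: "a \<bullet> a = 1" by (simp add: dot_square_norm)
  define C where "C = Q \<inter> {z. a \<bullet> z < b}"
  define D where "D = Q \<inter> {z. a \<bullet> z > b}"
  have conv: "convex C" "convex D"
    unfolding C_def D_def by (intro convex_Int Q(2) convex_halfspace_lt convex_halfspace_gt)+
  have off': "C \<inter> hyperplane q = {}" "D \<inter> hyperplane q = {}" if "q \<in> arrangement" for q
  proof -
    have "Q \<inter> hyperplane q = {} \<or> q = p" using off that by blast
    then show "C \<inter> hyperplane q = {}" "D \<inter> hyperplane q = {}"
      using hp by (auto simp: C_def D_def)
  qed
  have "x \<in> C \<inter> K" using x interior_subset ax by (auto simp: C_def)
  then have CK: "C \<subseteq> interior K"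
    using chamber_in_cell[OF K conv(1)] off'(1) by blast
  have near: "z \<in> closure C" "z \<in> closure D" if z: "z \<in> Q" "a \<bullet> z = b" for z
  proof -
    obtain r where r: "r > 0" "ball z r \<subseteq> Q" using Q(1) z(1) openE by blast
    have "z - min (r / 2) (e / 2) *\<^sub>R a \<in> C \<and> dist (z - min (r / 2) (e / 2) *\<^sub>R a) z < e"
      "z + min (r / 2) (e / 2) *\<^sub>R a \<in> D \<and> dist (z + min (r / 2) (e / 2) *\<^sub>R a) z < e" if "e > 0" for e
      using that r z \<open>norm a = 1\<close>
      by (auto simp: C_def D_def inner_diff_right inner_add_right aa dist_norm intro!: subsetD[OF r(2)])
    then show "z \<in> closure C" "z \<in> closure D"
      unfolding closure_approachable by blast+
  qed
  have "closure C \<subseteq> K"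
    using CK cell(7)[OF K] closure_mono by blast
  then have wall: "z \<in> K" if "z \<in> Q" "a \<bullet> z = b" for z
    using near(1)[OF that] by blast
  have DT: "D \<inter> \<Union>\<T> = {}"
  proof (rule ccontr)
    assume "\<not> ?thesis"
    then obtain M where M: "M \<in> \<T>" "D \<inter> M \<noteq> {}" by blast
    then have "D \<subseteq> interior M"
      using chamber_in_cell[OF M(1) conv(2) M(2)] off'(2) by blast
    then have "D \<subseteq> closure \<Omega>" "C \<subseteq> closure \<Omega>" "K \<subseteq> closure \<Omega>"
      using CK cell(5)[OF M(1)] cell(5)[OF K] interior_subset by blast+
    moreover have "Q \<subseteq> C \<union> D \<union> {z \<in> Q. a \<bullet> z = b}"
      by (auto simp: C_def D_def)
    ultimately have "Q \<subseteq> closure \<Omega>" using wall by blast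
    then have "Q \<subseteq> interior (closure \<Omega>)" using Q(1) by (rule interior_maximal)
    with not show False using lipschitz_domain_interior_closure[OF domain] by simp
  qed
  have ay: "a \<bullet> y = b" using y hp by blast
  have outside: "y \<notin> U" if "open U" "U \<subseteq> \<Union>\<T>" for U
  proof -
    have "U \<inter> D = {}" using that(2) DT by blast
    then show ?thesis
      using near(2)[OF y(1) ay] open_Int_closure_eq_empty[OF that(1), of D] by blast
  qed
  have "y \<in> K" using wall y ay by blast
  moreover have "y \<notin> interior K"
    using outside[of "interior K"] K interior_subset by blast
  ultimately have "y \<in> frontier K"
    using closure_subset by (auto simp: frontier_def)
  then obtain F q where F: "F facet_of K" "y \<in> F" "q \<in> arrangement" "hyperplane q = affine hull F"
    "y \<in> hyperplane q"
    using cell_frontier_arrangement[OF K] by metis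
  have "q = p" using off F(3,5) y(1) by blast
  with F have hF: "affine hull F = hyperplane p" by simp
  obtain r where r: "r > 0" "ball y r \<subseteq> Q" using Q(1) y(1) openE by blast
  have "ball y r \<inter> affine hull F \<subseteq> K \<inter> affine hull F"
    using wall r(2) hF hp by blast
  then have rel: "y \<in> rel_interior F"
    using F(2) r(1) facet_eq_Int_affine_hull[OF K F(1)] by (auto simp: mem_rel_interior_ball)
  have "y \<notin> \<Omega>"
    using outside[OF open_domain] Union_cells closure_subset by blast
  with \<open>y \<in> K\<close> cell(5)[OF K] open_domain have "y \<in> frontier \<Omega>"
    by (auto simp: frontier_def interior_open)
  then have "F \<subseteq> frontier \<Omega>" using facet_in_frontier[OF K F(1) rel] by blast
  with F(1) hF rel show thesis using that by blast
qed

lemma generic_point_in_cell: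
  assumes "x \<in> closure \<Omega>" "\<And>p. p \<in> arrangement \<Longrightarrow> x \<notin> hyperplane p"
  obtains K where "K \<in> \<T>" "x \<in> interior K"
proof -
  obtain K where K: "K \<in> \<T>" "x \<in> K" using assms(1) Union_cells by blast
  have "x \<notin> frontier K"
  proof
    assume "x \<in> frontier K"
    then obtain p where "p \<in> arrangement" "x \<in> hyperplane p"
      by (rule cell_frontier_arrangement[OF K(1)])
    with assms(2) show False by blast
  qed
  with K closure_subset show thesis using that by (auto simp: frontier_def)
qed

end

section \<open>Traces on facets\<close>

text \<open>An almost everywhere property holds on a dense set because relatively open subsets of a facet
  have positive area: the preimage of such a set under the orthogonal projection contains a ball of
  the prism over the facet.\<close>

lemma AE_facet_measure_dense:
  fixes F :: "'a::euclidean_space set"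
  assumes H: "affine hull F = {x. a \<bullet> x = b}" "norm a = 1" and "closed F"
    and ae: "AE x in facet_measure F. P x" and y: "y \<in> rel_interior F" and "e > 0"
  obtains z where "z \<in> F" "dist z y < e" "P z"
proof -
  have FH: "F \<subseteq> {x. a \<bullet> x = b}" using H(1) hull_subset by metis
  obtain n c where nc: "(SOME (n, c). norm n = 1 \<and> F \<subseteq> {x. n \<bullet> x = c}) = (n, c)"
    by fastforce
  have "case (n, c) of (n, c) \<Rightarrow> norm n = 1 \<and> F \<subseteq> {x. n \<bullet> x = c}"
    unfolding nc[symmetric] by (rule someI[of _ "(a, b)"]) (use H(2) FH in auto)
  then have n: "norm n = 1" "F \<subseteq> {x. n \<bullet> x = c}" by auto
  have "n \<noteq> 0" "a \<noteq> 0" using n(1) H(2) by auto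
  have "{x. a \<bullet> x = b} \<subseteq> {x. n \<bullet> x = c}"
    unfolding H(1)[symmetric] by (intro hull_minimal n(2) affine_hyperplane)
  moreover have "{x. a \<bullet> x = b} \<noteq> {}"
    using y rel_interior_subset FH by blast
  ultimately have hull: "affine hull F = {x. n \<bullet> x = c}"
    using affine_dim_equal[of "{x. a \<bullet> x = b}" "{x. n \<bullet> x = c}"] \<open>n \<noteq> 0\<close> \<open>a \<noteq> 0\<close> H(1)
    by (simp add: affine_hyperplane)
  define proj where "proj x = x - (n \<bullet> x - c) *\<^sub>R n" for x
  define S where "S = {x. c \<le> n \<bullet> x \<and> n \<bullet> x \<le> c + 1}"
  have S: "S \<in> sets borel"
    unfolding S_def by (intro borel_closed closed_Collect_conj closed_Collect_le continuous_intros)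
  have "F \<in> sets borel" using \<open>closed F\<close> by (rule borel_closed)
  have "continuous_on UNIV proj"
    unfolding proj_def[abs_def] by (intro continuous_intros)
  then have proj_meas: "proj \<in> restrict_space lborel S \<rightarrow>\<^sub>M borel"
    by (intro measurable_restrict_space1) (simp add: borel_measurable_continuous_onI)
  have measure_eq: "facet_measure F = restrict_space (completion (distr (restrict_space lborel S) borel proj)) F"
    by (simp add: facet_measure_def nc hyperplane_measure_def S_def proj_def[abs_def])
  from ae have "AE x in restrict_space (completion (distr (restrict_space lborel S) borel proj)) F. P x"
    unfolding measure_eq .
  then have "AE x in completion (distr (restrict_space lborel S) borel proj). x \<in> F \<longrightarrow> P x"
    by (subst (asm) AE_restrict_space_iff) (use \<open>F \<in> sets borel\<close> in auto)
  then have "AE x in distr (restrict_space lborel S) borel proj. x \<in> F \<longrightarrow> P x"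
    by (simp only: AE_completion_iff)
  from AE_distrD[OF proj_meas this]
  have ae': "AE x in lborel. x \<in> S \<longrightarrow> proj x \<in> F \<longrightarrow> P (proj x)"
    using S by (simp add: AE_restrict_space_iff)
  obtain d where d: "d > 0" "ball y d \<inter> affine hull F \<subseteq> F"
    using y by (auto simp: mem_rel_interior_ball)
  have ny: "n \<bullet> y = c" using y rel_interior_subset n(2) by blast
  have nn: "n \<bullet> n = 1" using n(1) by (simp add: dot_square_norm)
  define r where "r = Min {1/2, d, e}"
  have r: "0 < r" "r \<le> 1/2" "r \<le> d" "r \<le> e"
    using d(1) \<open>e > 0\<close> by (auto simp: r_def)
  \<comment> \<open>Half-way up the prism of height one, so that a ball of radius at most \<open>1/2\<close> stays inside.\<close>
  define B where "B = ball (y + (1/2) *\<^sub>R n) r"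
  have B: "x \<in> S" "dist (proj x) y < r" "n \<bullet> proj x = c" if "x \<in> B" for x
  proof -
    define w where "w = x - (y + (1/2) *\<^sub>R n)"
    have w: "norm w < r" using that by (simp add: B_def w_def dist_norm norm_minus_commute)
    have x: "x = y + (1/2) *\<^sub>R n + w" by (simp add: w_def)
    have nw: "\<bar>n \<bullet> w\<bar> \<le> norm w"
      using Cauchy_Schwarz_ineq2[of n w] n(1) by simp
    have nx: "n \<bullet> x = c + 1/2 + n \<bullet> w" by (simp add: x inner_add_right ny nn)
    moreover have "- 1/2 \<le> n \<bullet> w" "n \<bullet> w \<le> 1/2" using nw w r(2) by linarith+
    ultimately show "x \<in> S" by (simp add: S_def)
    have p: "proj x - y = w - (n \<bullet> w) *\<^sub>R n"
      by (simp add: proj_def nx) (simp add: x algebra_simps)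
    have "(norm (w - (n \<bullet> w) *\<^sub>R n))\<^sup>2 = (norm w)\<^sup>2 - (n \<bullet> w)\<^sup>2"
      unfolding power2_norm_eq_inner
      by (simp add: inner_diff_left inner_diff_right nn inner_commute power2_eq_square)
    then have "(norm (w - (n \<bullet> w) *\<^sub>R n))\<^sup>2 \<le> (norm w)\<^sup>2" by simp
    then have "norm (w - (n \<bullet> w) *\<^sub>R n) \<le> norm w"
      by (rule power2_le_imp_le) simp
    with w p show "dist (proj x) y < r" by (simp add: dist_norm)
    show "n \<bullet> proj x = c" by (simp add: proj_def inner_diff_right nn)
  qed
  have "\<exists>x\<in>B. x \<in> S \<longrightarrow> proj x \<in> F \<longrightarrow> P (proj x)"
  proof (rule ccontr)
    assume "\<not> ?thesis"
    with ae' have "AE x in lborel. x \<notin> B" by (auto elim!: eventually_mono)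
    then have "AE x in lebesgue. x \<notin> B" by (simp add: AE_completion_iff)
    then have "B \<in> null_sets lebesgue"
      by (subst (asm) AE_iff_null_sets[symmetric]) (auto simp: B_def)
    then have "negligible B" by (simp add: negligible_iff_null_sets)
    then show False using open_not_negligible[of B] r(1) by (simp add: B_def)
  qed
  then obtain x where x: "x \<in> B" "proj x \<in> F \<longrightarrow> P (proj x)" using B(1) by blast
  have "proj x \<in> ball y d \<inter> affine hull F"
    using B(2,3)[OF x(1)] r(3) by (auto simp: hull dist_commute)
  then have "proj x \<in> F" using d(2) by blast
  with x(2) B(2)[OF x(1)] r(4) show thesis using that[of "proj x"] by auto
qed

text \<open>Inside the cell \<open>f\<close> agrees with a continuous function, so the one-sided limit is its value.\<close>

lemma side_trace_eq:
  assumes "y islimpt interior K" "\<And>x. x \<in> interior K \<Longrightarrow> f x = p x" "isCont p y"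
  shows "side_trace K f y = p y"
  unfolding side_trace_def
proof (rule tendsto_Lim)
  show "\<not> trivial_limit (at y within interior K)" using assms(1) by (simp add: trivial_limit_within)
  have "(p \<longlongrightarrow> p y) (at y within interior K)"
    using assms(3) unfolding isCont_def by (rule tendsto_within_subset) simp
  then show "(f \<longlongrightarrow> p y) (at y within interior K)"
    by (rule Lim_transform_eventually) (auto simp: eventually_at_filter assms(2))
qed

lemma side_trace_cong:
  assumes "\<And>x. x \<in> interior K \<Longrightarrow> f x = g x"
  shows "side_trace K f y = side_trace K g y"
proof -
  have "(f \<longlongrightarrow> l) (at y within interior K) \<longleftrightarrow> (g \<longlongrightarrow> l) (at y within interior K)" for l
    using assms by (intro Lim_cong_within) auto
  then show ?thesis by (simp add: side_trace_def Topological_Spaces.Lim_def)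
qed

context polytopal_mesh
begin

lemma facet_limit_point:
  assumes "K \<in> \<T>" "F facet_of K" "y \<in> F"
  shows "y islimpt interior K"
proof -
  have "F face_of K" "F \<noteq> K" using assms(2) facet_of_imp_face_of facet_of_irrefl by blast+
  then have "y \<notin> interior K"
    using face_of_disjoint_interior assms(3) by blast
  moreover have "y \<in> closure (interior K)"
    using cell(7)[OF assms(1)] facet_of_imp_subset[OF assms(2)] assms(3) by blast
  ultimately show ?thesis by (auto simp: closure_def)
qed

lemma facet_closed: "K \<in> \<T> \<Longrightarrow> F facet_of K \<Longrightarrow> closed F"
  using cell(2,3) face_of_imp_closed facet_of_imp_face_of by blast

text \<open>Almost everywhere on a facet means densely, and the trace of a polynomial is continuous.\<close>

lemma boundary_normal_trace_zero:
  assumes K: "K \<in> \<T>" and F: "F facet_of K" "F \<subseteq> frontier \<Omega>"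
    and v: "normal_vanishes \<Omega> \<T> v" "\<And>x. x \<in> interior K \<Longrightarrow> v x = p x" "continuous_on UNIV p"
    and y: "y \<in> rel_interior F" and hp: "affine hull F = {x. a \<bullet> x = b}" "norm a = 1"
  shows "p y \<bullet> a = 0"
proof (rule ccontr)
  assume not0: "p y \<bullet> a \<noteq> 0"
  obtain c d where cd: "norm c = 1" "K \<subseteq> {x. c \<bullet> x \<le> d}" "affine hull F = {x. c \<bullet> x = d}"
    using facet_hyperplane[OF K F(1)] by metis
  then have c: "c = a \<or> c = - a" using unit_hyperplanes_eq[of a c b d] hp by auto
  have "AE x in facet_measure F. side_trace K v x \<bullet> c = 0"
    using v(1) K F outer_normal_eq[OF K F(1) cd] by (auto simp: normal_vanishes_def)
  have "isCont (\<lambda>x. p x \<bullet> a) y"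
    using v(3) by (auto intro!: continuous_intros simp: continuous_on_eq_continuous_at)
  then obtain e where e: "e > 0" "\<And>z. dist z y < e \<Longrightarrow> dist (p z \<bullet> a) (p y \<bullet> a) < \<bar>p y \<bullet> a\<bar>"
    using not0 unfolding continuous_at_eps_delta dist_commute[of y] by (metis zero_less_abs_iff)
  obtain z where z: "z \<in> F" "dist z y < e" "side_trace K v z \<bullet> c = 0"
    using AE_facet_measure_dense[OF hp facet_closed[OF K F(1)] \<open>AE x in facet_measure F. _\<close> y e(1)]
    by metis
  have "side_trace K v z = p z"
    using facet_limit_point[OF K F(1) z(1)] v(2,3) by (intro side_trace_eq) (auto simp: continuous_on_eq_continuous_at)
  with z(3) c have "p z \<bullet> a = 0" by auto
  with e(2)[OF z(2)] show False by (simp add: dist_real_def)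
qed

end

section \<open>Square-integrable functions\<close>

lemma square_integrable_integrable:
  assumes "square_integrable \<Omega> f" "\<Omega> \<in> lmeasurable"
  shows "integrable (lebesgue_on \<Omega>) f"
proof (rule Bochner_Integration.integrable_bound)
  show "integrable (lebesgue_on \<Omega>) (\<lambda>x. 1 + (norm (f x))\<^sup>2)"
    using assms by (intro Bochner_Integration.integrable_add)
      (auto simp: square_integrable_def finite_measure.integrable_const finite_measure_lebesgue_on)
  show "f \<in> borel_measurable (lebesgue_on \<Omega>)" using assms by (simp add: square_integrable_def)
  have "a \<le> 1 + a\<^sup>2" for a :: real
    using sum_power2_ge_zero[of "a - 1/2" 0] by (simp add: power2_eq_square algebra_simps)
  then show "AE x in lebesgue_on \<Omega>. norm (f x) \<le> norm (1 + (norm (f x))\<^sup>2)" by simp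
qed

lemma square_integrable_add:
  fixes f g :: "'a::euclidean_space \<Rightarrow> 'b::euclidean_space"
  assumes "square_integrable \<Omega> f" "square_integrable \<Omega> g"
  shows "square_integrable \<Omega> (\<lambda>x. f x + g x)"
proof -
  have m: "(\<lambda>x. f x + g x) \<in> borel_measurable (lebesgue_on \<Omega>)"
    using assms by (auto simp: square_integrable_def)
  have "integrable (lebesgue_on \<Omega>) (\<lambda>x. (norm (f x + g x))\<^sup>2)"
  proof (rule Bochner_Integration.integrable_bound)
    show "integrable (lebesgue_on \<Omega>) (\<lambda>x. 2 * (norm (f x))\<^sup>2 + 2 * (norm (g x))\<^sup>2)"
      using assms by (intro Bochner_Integration.integrable_add integrable_mult_right)
        (auto simp: square_integrable_def)
    show "(\<lambda>x. (norm (f x + g x))\<^sup>2) \<in> borel_measurable (lebesgue_on \<Omega>)"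
      using m by measurable
    have "(norm (a + b))\<^sup>2 \<le> 2 * (norm a)\<^sup>2 + 2 * (norm b)\<^sup>2" for a b :: 'b
    proof -
      have "(norm (a + b))\<^sup>2 \<le> (norm a + norm b)\<^sup>2"
        by (intro power_mono norm_triangle_ineq) simp
      also have "\<dots> \<le> 2 * (norm a)\<^sup>2 + 2 * (norm b)\<^sup>2"
        using zero_le_power2[of "norm a - norm b"] by (simp add: power2_eq_square algebra_simps)
      finally show ?thesis .
    qed
    then show "AE x in lebesgue_on \<Omega>. norm ((norm (f x + g x))\<^sup>2)
        \<le> norm (2 * (norm (f x))\<^sup>2 + 2 * (norm (g x))\<^sup>2)"
      by (intro AE_I2) simp
  qed
  with m show ?thesis by (simp add: square_integrable_def)
qed

lemma square_integrable_scaleR: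
  "square_integrable \<Omega> f \<Longrightarrow> square_integrable \<Omega> (\<lambda>x. c *\<^sub>R f x)"
  by (auto simp: square_integrable_def power_mult_distrib)

text \<open>The Cauchy-Schwarz inequality against the constant function, from the discriminant of the
  nonnegative quadratic polynomial \<open>c \<mapsto> \<integral> (f - c)\<^sup>2\<close>.\<close>

lemma abs_integral_le_l2norm:
  assumes "square_integrable \<Omega> f" "\<Omega> \<in> lmeasurable"
  shows "\<bar>\<integral>x. f x \<partial>lebesgue_on \<Omega>\<bar> \<le> sqrt (measure lebesgue \<Omega>) * l2norm \<Omega> f"
proof -
  define A where "A = (\<integral>x. f x \<partial>lebesgue_on \<Omega>)"
  define m where "m = measure lebesgue \<Omega>"
  have fi: "integrable (lebesgue_on \<Omega>) f" by (rule square_integrable_integrable) fact+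
  have f2: "integrable (lebesgue_on \<Omega>) (\<lambda>x. (f x)\<^sup>2)" using assms(1) by (simp add: square_integrable_def)
  have ci: "integrable (lebesgue_on \<Omega>) (\<lambda>x. c :: real)" for c
    using assms(2) by (simp add: finite_measure.integrable_const finite_measure_lebesgue_on)
  have total: "measure (lebesgue_on \<Omega>) \<Omega> = m"
    using assms(2) by (simp add: m_def measure_restrict_space fmeasurableD)
  have quad: "0 \<le> ip \<Omega> f f - 2 * c * A + c\<^sup>2 * m" for c
  proof -
    have "0 \<le> (\<integral>x. (f x - c)\<^sup>2 \<partial>lebesgue_on \<Omega>)" by (rule Bochner_Integration.integral_nonneg) simp
    also have "\<dots> = (\<integral>x. ((f x)\<^sup>2 - 2 * c * f x) + c\<^sup>2 \<partial>lebesgue_on \<Omega>)"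
      by (simp add: power2_eq_square algebra_simps)
    also have "\<dots> = (\<integral>x. (f x)\<^sup>2 \<partial>lebesgue_on \<Omega>) - 2 * c * A + c\<^sup>2 * m"
      using fi f2 ci by (simp add: A_def total)
    finally show ?thesis by (simp add: ip_def power2_eq_square)
  qed
  have "A\<^sup>2 \<le> m * ip \<Omega> f f"
  proof (cases "m = 0")
    case True
    have "A = 0"
    proof (rule ccontr)
      assume "A \<noteq> 0"
      then show False using quad[of "(ip \<Omega> f f + 1) / (2 * A)"] True by simp
    qed
    then show ?thesis using True by simp
  next
    case False
    then have "m > 0" by (simp add: m_def zero_less_measure_iff)
    then show ?thesis using quad[of "A / m"] by (simp add: field_simps power2_eq_square)
  qed
  then have "\<bar>A\<bar> \<le> sqrt (m * ip \<Omega> f f)" by (metis real_sqrt_abs real_sqrt_le_mono)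
  then show ?thesis by (simp add: A_def m_def l2norm_def real_sqrt_mult)
qed

context polytopal_mesh
begin

lemma domain_lmeasurable: "\<Omega> \<in> lmeasurable"
  using open_domain bounded_domain by (simp add: lmeasurable_open)

text \<open>Off the arrangement every point of the domain is interior to a cell; the remaining points form a
  null set.\<close>

lemma AE_off_arrangement:
  "AE x in lebesgue_on \<Omega>. \<forall>p\<in>arrangement. x \<notin> hyperplane p"
proof -
  have "negligible (\<Union>p\<in>arrangement. hyperplane p)"
  proof (rule negligible_Union)
    show "finite (hyperplane ` arrangement)" using finite_arrangement by simp
    fix H assume "H \<in> hyperplane ` arrangement"
    then obtain p where p: "p \<in> arrangement" "H = hyperplane p" by blast
    have "fst p \<noteq> 0" using arrangement_unit[OF p(1)] by auto
    then show "negligible H" unfolding p(2) by (intro negligible_hyperplane) simp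
  qed
  then have "AE x in lebesgue. x \<notin> (\<Union>p\<in>arrangement. hyperplane p)"
    by (intro AE_not_in) (simp add: negligible_iff_null_sets)
  then show ?thesis
    using domain_lmeasurable by (subst AE_restrict_space_iff) (auto elim!: eventually_mono simp: fmeasurableD)
qed

text \<open>On the mesh skeleton the function is arbitrary, but the skeleton is a null set and Lebesgue
  measure is complete.\<close>

lemma piecewise_polynomial_square_integrable:
  fixes f :: "'a \<Rightarrow> 'b::euclidean_space"
  assumes "piecewise_polynomial \<T> f"
  shows "square_integrable \<Omega> f"
proof -
  let ?N = "\<Omega> - (\<Union>K\<in>\<T>. interior K)"
  have AEcell: "AE x in lebesgue_on \<Omega>. x \<in> (\<Union>K\<in>\<T>. interior K)"
  proof -
    have "AE x in lebesgue_on \<Omega>. x \<in> \<Omega>" by (rule AE_I2) simp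
    with AE_off_arrangement show ?thesis
    proof eventually_elim
      case (elim x)
      then have "x \<in> closure \<Omega>" using closure_subset by blast
      then obtain K where "K \<in> \<T>" "x \<in> interior K"
        using elim(1) generic_point_in_cell by blast
      then show ?case by blast
    qed
  qed
  have \<Omega>: "\<Omega> \<in> sets lebesgue" using domain_lmeasurable by (rule fmeasurableD)
  have N: "?N \<in> sets lebesgue"
    by (intro sets.Diff \<Omega> sets.finite_UN finite_cells) simp
  have "AE x in lebesgue. x \<notin> ?N"
    using AEcell \<Omega> by (subst (asm) AE_restrict_space_iff) (auto elim!: eventually_mono)
  then have null: "negligible ?N"
    using AE_iff_null_sets[OF N] by (simp add: negligible_iff_null_sets)
  have "\<forall>K\<in>\<T>. \<exists>p. polynomial_function p \<and> (\<forall>x\<in>interior K. f x = p x)"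
    using assms by (simp add: piecewise_polynomial_def)
  then obtain P where "\<forall>K\<in>\<T>. polynomial_function (P K) \<and> (\<forall>x\<in>interior K. f x = P K x)"
    by (rule bchoice[THEN exE])
  then have P: "polynomial_function (P K)" "\<And>x. x \<in> interior K \<Longrightarrow> f x = P K x" if "K \<in> \<T>" for K
    using that by auto
  have Pcont: "continuous_on S (P K)" if "K \<in> \<T>" for S K
    using P(1)[OF that] by (meson continuous_at_imp_continuous_on continuous_polymonial_function)
  have meas: "f \<in> borel_measurable (lebesgue_on \<Omega>)"
  proof (rule borel_measurableI)
    fix S :: "'b set" assume S: "open S"
    have "f -` S \<inter> \<Omega> = (\<Union>K\<in>\<T>. P K -` S \<inter> interior K) \<union> (f -` S \<inter> ?N)"
      using P(2) cell(6) by auto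
    moreover have "(\<Union>K\<in>\<T>. P K -` S \<inter> interior K) \<in> sets lebesgue"
    proof (intro sets.finite_UN finite_cells)
      fix K assume "K \<in> \<T>"
      then have "open (P K -` S \<inter> interior K)"
        using S Pcont[of K "interior K"] by (simp add: continuous_on_open_vimage)
      then show "P K -` S \<inter> interior K \<in> sets lebesgue" by simp
    qed
    moreover have "f -` S \<inter> ?N \<in> sets lebesgue"
      using negligible_subset[OF null, of "f -` S \<inter> ?N"] negligible_imp_sets by blast
    ultimately have "f -` S \<inter> \<Omega> \<in> sets lebesgue" by simp
    then show "f -` S \<inter> space (lebesgue_on \<Omega>) \<in> sets (lebesgue_on \<Omega>)"
      using \<Omega> by (auto simp: sets_restrict_space_iff)
  qed
  have "\<exists>B\<ge>0. \<forall>K\<in>\<T>. \<forall>x\<in>K. norm (P K x) \<le> B"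
  proof (rule finite_uniform_bound[of \<T> "\<lambda>K b. \<forall>x\<in>K. norm (P K x) \<le> b"])
    fix K assume "K \<in> \<T>"
    then have "bounded (P K ` K)"
      using cell(1) polytope_imp_compact by (intro compact_imp_bounded compact_continuous_image Pcont) auto
    then show "\<exists>b. \<forall>x\<in>K. norm (P K x) \<le> b" by (auto simp: bounded_iff)
  qed (use finite_cells in force)+
  then obtain B where B: "B \<ge> 0" "\<And>K x. K \<in> \<T> \<Longrightarrow> x \<in> K \<Longrightarrow> norm (P K x) \<le> B" by blast
  have "AE x in lebesgue_on \<Omega>. norm ((norm (f x))\<^sup>2) \<le> B\<^sup>2"
    using AEcell
  proof eventually_elim
    case (elim x)
    then obtain K where K: "K \<in> \<T>" "x \<in> interior K" by blast
    then have "norm (f x) \<le> B" using B(2)[OF K(1)] P(2)[OF K] interior_subset by auto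
    then show ?case by (simp add: power_mono)
  qed
  moreover have "(\<lambda>x. (norm (f x))\<^sup>2) \<in> borel_measurable (lebesgue_on \<Omega>)" using meas by measurable
  ultimately have "integrable (lebesgue_on \<Omega>) (\<lambda>x. (norm (f x))\<^sup>2)"
    by (rule finite_measure.integrable_const_bound[OF finite_measure_lebesgue_on[OF domain_lmeasurable]])
  with meas show ?thesis by (simp add: square_integrable_def)
qed

end

section \<open>The total divergence of a field with vanishing normal trace\<close>

context polytopal_mesh
begin

text \<open>Far from all hyperplanes the gradient is zero. Near exactly one of them the normal component of
  \<open>v\<close> is \<open>O(\<delta>)\<close> wherever the gradient, of size \<open>O(1/\<delta>)\<close>, does not vanish. Near two of them only
  the size of the gradient is used.\<close>

lemma cutoff_flux_bound:
  assumes v: "piecewise_polynomial \<T> v" "normal_vanishes \<Omega> \<T> v" and R: "closure \<Omega> \<subseteq> cball 0 R"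
  obtains C where "C \<ge> 0"
    "\<And>\<delta> x. \<delta> > 0 \<Longrightarrow> x \<in> \<Omega> \<Longrightarrow> (\<And>p. p \<in> arrangement \<Longrightarrow> x \<notin> hyperplane p) \<Longrightarrow>
       \<bar>v x \<bullet> gradient (cutoff arrangement \<Omega> \<delta>) x\<bar> \<le>
         C * (\<Sum>p\<in>arrangement. indicator (strip p (2 * \<delta>)) x) +
         C / \<delta> * (\<Sum>(p, q)\<in>{(p, q) \<in> arrangement \<times> arrangement. p \<noteq> q}.
           indicator (strip p (2 * \<delta>) \<inter> strip q (2 * \<delta>)) x)"
proof -
  let ?A = arrangement
  note A = finite_arrangement
  let ?D = "{(p, q) \<in> ?A \<times> ?A. p \<noteq> q}"
  have "\<forall>K\<in>\<T>. \<exists>p. polynomial_function p \<and> (\<forall>x\<in>interior K. v x = p x)"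
    using v(1) by (simp add: piecewise_polynomial_def)
  then obtain P where "\<forall>K\<in>\<T>. polynomial_function (P K) \<and> (\<forall>x\<in>interior K. v x = P K x)"
    by (rule bchoice[THEN exE])
  then have P: "polynomial_function (P K)" "\<And>x. x \<in> interior K \<Longrightarrow> v x = P K x" if "K \<in> \<T>" for K
    using that by auto
  have Pcont: "continuous_on S (P K)" if "K \<in> \<T>" for S K
    using P(1)[OF that] by (meson continuous_at_imp_continuous_on continuous_polymonial_function)
  have "\<exists>B\<ge>0. \<forall>K\<in>\<T>. \<forall>x\<in>cball 0 R. norm (P K x) \<le> B"
  proof (rule finite_uniform_bound[of \<T> "\<lambda>K b. \<forall>x\<in>cball 0 R. norm (P K x) \<le> b"])
    fix K assume "K \<in> \<T>"
    then have "bounded (P K ` cball 0 R)"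
      by (intro compact_imp_bounded compact_continuous_image Pcont) auto
    then show "\<exists>b. \<forall>x\<in>cball 0 R. norm (P K x) \<le> b" by (auto simp: bounded_iff)
  qed (use finite_cells in force)+
  then obtain B where B: "B \<ge> 0" "\<And>K. K \<in> \<T> \<Longrightarrow> \<forall>x\<in>cball 0 R. norm (P K x) \<le> B"
    by blast
  have "\<exists>L\<ge>0. \<forall>i\<in>\<T> \<times> ?A.
      \<forall>x\<in>cball 0 R. \<forall>y\<in>cball 0 R. \<bar>P (fst i) x \<bullet> fst (snd i) - P (fst i) y \<bullet> fst (snd i)\<bar> \<le> L * norm (x - y)"
  proof (rule finite_uniform_bound[of "\<T> \<times> ?A" "\<lambda>i b. \<forall>x\<in>cball 0 R. \<forall>y\<in>cball 0 R.
        \<bar>P (fst i) x \<bullet> fst (snd i) - P (fst i) y \<bullet> fst (snd i)\<bar> \<le> b * norm (x - y)"])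
    show "finite (\<T> \<times> ?A)" using finite_cells A by simp
    fix i assume "i \<in> \<T> \<times> ?A"
    then show "\<exists>b. \<forall>x\<in>cball 0 R. \<forall>y\<in>cball 0 R.
        \<bar>P (fst i) x \<bullet> fst (snd i) - P (fst i) y \<bullet> fst (snd i)\<bar> \<le> b * norm (x - y)"
      using real_polynomial_lipschitz[OF real_polynomial_function_inner[OF P(1)[of "fst i"]], of R "fst (snd i)"]
      by (auto simp: mem_Times_iff)
  next
    fix i and b c :: real
    assume *: "\<forall>x\<in>cball 0 R. \<forall>y\<in>cball 0 R.
        \<bar>P (fst i) x \<bullet> fst (snd i) - P (fst i) y \<bullet> fst (snd i)\<bar> \<le> b * norm (x - y)" and "b \<le> c"
    have "b * norm (x - y) \<le> c * norm (x - y)" for x y :: 'a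
      using \<open>b \<le> c\<close> by (intro mult_right_mono) auto
    with * show "\<forall>x\<in>cball 0 R. \<forall>y\<in>cball 0 R.
        \<bar>P (fst i) x \<bullet> fst (snd i) - P (fst i) y \<bullet> fst (snd i)\<bar> \<le> c * norm (x - y)"
      by (meson order_trans)
  qed
  then obtain L where L: "L \<ge> 0" "\<And>i. i \<in> \<T> \<times> ?A \<Longrightarrow>
      \<forall>x\<in>cball 0 R. \<forall>y\<in>cball 0 R. \<bar>P (fst i) x \<bullet> fst (snd i) - P (fst i) y \<bullet> fst (snd i)\<bar> \<le> L * norm (x - y)"
    by blast
  obtain G where G: "G > 0"
    "\<And>\<Omega> \<delta> x. \<delta> > 0 \<Longrightarrow> \<exists>D. GDERIV (cutoff ?A \<Omega> \<delta>) x :> D \<and> norm D \<le> G / \<delta>"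
    using cutoff_gradient_bound[OF A arrangement_unit] by blast
  define C where "C = max (B * G) (2 * L * G)"
  have "C \<ge> 0" using B(1) G(1) by (simp add: C_def le_max_iff_disj)
  moreover have "\<bar>v x \<bullet> gradient (cutoff ?A \<Omega> \<delta>) x\<bar> \<le>
         C * (\<Sum>p\<in>?A. indicator (strip p (2 * \<delta>)) x) +
         C / \<delta> * (\<Sum>(p, q)\<in>?D. indicator (strip p (2 * \<delta>) \<inter> strip q (2 * \<delta>)) x)"
    (is "?lhs \<le> C * ?s1 + C / \<delta> * ?s2")
    if \<delta>: "\<delta> > 0" and x: "x \<in> \<Omega>" and off: "\<And>p. p \<in> ?A \<Longrightarrow> x \<notin> hyperplane p" for \<delta> x
  proof -
    have xcl: "x \<in> closure \<Omega>" using x closure_subset by blast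
    obtain K where K: "K \<in> \<T>" "x \<in> interior K"
      using generic_point_in_cell[OF xcl off] by blast
    have xR: "x \<in> cball 0 R" using xcl R by blast
    obtain D where D: "GDERIV (cutoff ?A \<Omega> \<delta>) x :> D" "norm D \<le> G / \<delta>" using G(2)[OF \<delta>] by blast
    have grad: "gradient (cutoff ?A \<Omega> \<delta>) x = D" using gradient_eq D(1) by blast
    have s: "0 \<le> ?s1" "0 \<le> ?s2" by (auto intro!: sum_nonneg)
    have rhs0: "0 \<le> C * ?s1" "0 \<le> C / \<delta> * ?s2"
      using s \<open>C \<ge> 0\<close> \<delta> by (auto intro!: mult_nonneg_nonneg divide_nonneg_nonneg)
    consider (two) p q where "p \<in> ?A" "q \<in> ?A" "p \<noteq> q" "x \<in> strip p (2 * \<delta>)" "x \<in> strip q (2 * \<delta>)"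
      | (none) "\<And>p. p \<in> ?A \<Longrightarrow> x \<notin> strip p (2 * \<delta>)"
      | (one) p where "p \<in> ?A" "x \<in> strip p (2 * \<delta>)" "\<And>q. q \<in> ?A \<Longrightarrow> q \<noteq> p \<Longrightarrow> x \<notin> strip q (2 * \<delta>)"
      by metis
    then show ?thesis
    proof cases
      case two
      have "?lhs \<le> norm (v x) * norm D" unfolding grad by (rule Cauchy_Schwarz_ineq2)
      also have "\<dots> \<le> B * (G / \<delta>)"
        using B P(2)[OF K] K(1) xR D(2) by (intro mult_mono) auto
      also have "\<dots> \<le> C / \<delta>" using \<delta> by (simp add: C_def divide_right_mono)
      also have "\<dots> = C / \<delta> * 1" by simp
      also have "\<dots> \<le> C / \<delta> * ?s2"
      proof (rule mult_left_mono)
        have "finite ?D" by (rule finite_subset[of _ "?A \<times> ?A"]) (use A in auto)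
        moreover have "(p, q) \<in> ?D" using two by simp
        ultimately have "(case (p, q) of (p, q) \<Rightarrow> indicator (strip p (2 * \<delta>) \<inter> strip q (2 * \<delta>)) x) \<le> ?s2"
          by (intro member_le_sum) auto
        then show "1 \<le> ?s2" using two by simp
        show "0 \<le> C / \<delta>" using \<open>C \<ge> 0\<close> \<delta> by simp
      qed
      finally show ?thesis using rhs0 by linarith
    next
      case none
      have "GDERIV (cutoff ?A \<Omega> \<delta>) x :> 0"
        using none by (intro cutoff_gradient_far A \<delta>) (simp add: strip_def not_le)
      then have "D = 0" using GDERIV_unique D(1) by blast
      then show ?thesis using rhs0 grad by simp
    next
      case one
      have far: "2 * \<delta> < \<bar>level q x\<bar>" if "q \<in> ?A" "q \<noteq> p" for q
        using one(3)[OF that] by (simp add: strip_def)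
      have np: "norm (fst p) = 1" using arrangement_unit one(1) by blast
      have near: "\<bar>level p x\<bar> \<le> 2 * \<delta>" using one(2) by (simp add: strip_def)
      \<comment> \<open>The chamber of \<open>x\<close> in the arrangement without \<open>p\<close>. Either it lies in the domain and the cutoff is
        constant near \<open>x\<close>, or \<open>p\<close> carries a boundary facet next to \<open>x\<close>.\<close>
      define Q where "Q = {z. \<forall>q\<in>?A - {p}. 0 < sgn (level q x) * level q z}"
      have "?lhs \<le> C"
      proof (cases "Q \<subseteq> \<Omega>")
        case True
        have "GDERIV (cutoff ?A \<Omega> \<delta>) x :> 0"
        proof (rule GDERIV_cong_open[OF GDERIV_const])
          show "open (far_neighbourhood (?A - {p}) \<delta> x)" using A by (simp add: open_far_neighbourhood)
          show "x \<in> far_neighbourhood (?A - {p}) \<delta> x"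
            by (rule far_neighbourhood_self) (use far in blast)
          show "cutoff ?A \<Omega> \<delta> y = 1" if "y \<in> far_neighbourhood (?A - {p}) \<delta> x" for y
            using cutoff_eq_1[OF A \<delta> _ that] True by (simp add: Q_def)
        qed
        then have "D = 0" using GDERIV_unique D(1) by blast
        then show ?thesis using grad \<open>C \<ge> 0\<close> by simp
      next
        case False
        \<comment> \<open>The projection of \<open>x\<close> to \<open>hyperplane p\<close> stays in the chamber, because the other hyperplanes are
          further away than \<open>hyperplane p\<close>.\<close>
        define y where "y = x - level p x *\<^sub>R fst p"
        have y: "y \<in> hyperplane p" using np by (simp add: y_def inner_diff_right dot_square_norm)
        have yQ: "y \<in> Q"
          unfolding Q_def
        proof (intro CollectI ballI)
          fix q assume q: "q \<in> ?A - {p}"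
          have "\<bar>fst q \<bullet> fst p\<bar> \<le> 1"
            using Cauchy_Schwarz_ineq2[of "fst q" "fst p"] np arrangement_unit[of q] q by simp
          then have "\<bar>level p x * (fst q \<bullet> fst p)\<bar> \<le> 2 * \<delta> * 1"
            unfolding abs_mult using near \<delta> by (intro mult_mono) auto
          moreover have "level q y = level q x - level p x * (fst q \<bullet> fst p)"
            by (simp add: y_def inner_diff_right)
          ultimately show "0 < sgn (level q x) * level q y"
            using far[of q] q by (auto simp: sgn_if)
        qed
        have xQ: "x \<in> Q"
          unfolding Q_def using off by (fastforce intro: sgn_times_self_pos)
        have Qeq: "Q = (\<Inter>q\<in>?A - {p}. {z. 0 < sgn (level q x) * level q z})"
          by (auto simp: Q_def)
        have half: "{z. 0 < sgn (level q x) * level q z} =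
            {z. (sgn (level q x) *\<^sub>R fst q) \<bullet> z > sgn (level q x) * snd q}" for q
          by (auto simp: algebra_simps)
        have "open Q" unfolding Qeq using A
          by (intro open_INT ballI) (auto intro!: open_Collect_less continuous_intros)
        moreover have "convex Q" unfolding Qeq half by (intro convex_INT convex_halfspace_gt)
        moreover have "Q \<inter> hyperplane q = {}" if "q \<in> ?A" "q \<noteq> p" for q
        proof -
          have "0 < sgn (level q x) * level q z" if "z \<in> Q" for z
            using that \<open>q \<in> ?A\<close> \<open>q \<noteq> p\<close> by (simp add: Q_def)
          then show ?thesis by force
        qed
        ultimately obtain F where F: "F facet_of K" "F \<subseteq> frontier \<Omega>" "affine hull F = hyperplane p"
          "y \<in> rel_interior F"
          using crossing_wall[OF one(1) _ _ _ K(1) xQ K(2) off[OF one(1)] yQ y False] by metis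
        \<comment> \<open>The normal component vanishes at \<open>y\<close>, so the Lipschitz bound makes it \<open>O(\<delta>)\<close> at \<open>x\<close>, which
          compensates for the factor \<open>1/\<delta>\<close> in the gradient.\<close>
        have tr: "P K y \<bullet> fst p = 0"
          by (rule boundary_normal_trace_zero[OF K(1) F(1,2) v(2) P(2)[OF K(1)] Pcont[OF K(1)] F(4)])
            (use F(3) np in auto)
        have "y \<in> cball 0 R"
          using F(1,4) rel_interior_subset facet_of_imp_subset cell(5)[OF K(1)] R by blast
        then have "\<bar>P K x \<bullet> fst p - P K y \<bullet> fst p\<bar> \<le> L * norm (x - y)"
          using L(2)[of "(K, p)"] K(1) one(1) xR by simp
        also have "\<dots> = L * \<bar>level p x\<bar>" using np by (simp add: y_def)
        also have "\<dots> \<le> L * (2 * \<delta>)" using L(1) near by (intro mult_left_mono)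
        finally have vp: "\<bar>v x \<bullet> fst p\<bar> \<le> L * (2 * \<delta>)" using tr P(2)[OF K] by simp
        obtain c where "GDERIV (cutoff ?A \<Omega> \<delta>) x :> c *\<^sub>R fst p"
          using cutoff_gradient_parallel[OF A \<delta> one(1) np far] by blast
        then have Dc: "D = c *\<^sub>R fst p" using GDERIV_unique D(1) by blast
        then have "\<bar>c\<bar> \<le> G / \<delta>" using D(2) np by simp
        have "?lhs = \<bar>c\<bar> * \<bar>v x \<bullet> fst p\<bar>" by (simp add: grad Dc abs_mult)
        also have "\<dots> \<le> (G / \<delta>) * (L * (2 * \<delta>))"
          using \<open>\<bar>c\<bar> \<le> G / \<delta>\<close> vp G(1) \<delta> by (intro mult_mono) auto
        also have "\<dots> \<le> C" using \<delta> by (simp add: C_def mult_ac)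
        finally show ?thesis .
      qed
      also have "C = C * 1" by simp
      also have "\<dots> \<le> C * ?s1"
      proof (rule mult_left_mono[OF _ \<open>C \<ge> 0\<close>])
        have "indicator (strip p (2 * \<delta>)) x \<le> ?s1"
          using one(1) A by (intro member_le_sum) auto
        then show "1 \<le> ?s1" using one(2) by simp
      qed
      finally show ?thesis using rhs0 by linarith
    qed
  qed
  ultimately show thesis using that by blast
qed

text \<open>Integrate the pointwise bound: the strips have measure \<open>o(1)\<close>, and their pairwise
  intersections have measure \<open>o(\<delta>)\<close>.\<close>

lemma cutoff_flux_small:
  assumes v: "piecewise_polynomial \<T> v" "normal_vanishes \<Omega> \<T> v" and "e > 0"
  shows "\<forall>\<^sub>F \<delta> in at_right 0. \<bar>ip \<Omega> v (gradient (cutoff arrangement \<Omega> \<delta>))\<bar> \<le> e"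
proof -
  let ?A = arrangement
  let ?D = "{(p, q) \<in> ?A \<times> ?A. p \<noteq> q}"
  have fD: "finite ?D" by (rule finite_subset[of _ "?A \<times> ?A"]) (use finite_arrangement in auto)
  obtain R where "\<forall>x\<in>closure \<Omega>. norm x \<le> R"
    using bounded_closure[OF bounded_domain] by (auto simp: bounded_iff)
  then have R: "closure \<Omega> \<subseteq> cball 0 R" by auto
  obtain C where C: "C \<ge> 0"
    "\<And>\<delta> x. \<delta> > 0 \<Longrightarrow> x \<in> \<Omega> \<Longrightarrow> (\<And>p. p \<in> ?A \<Longrightarrow> x \<notin> hyperplane p) \<Longrightarrow>
       \<bar>v x \<bullet> gradient (cutoff ?A \<Omega> \<delta>) x\<bar> \<le> C * (\<Sum>p\<in>?A. indicator (strip p (2 * \<delta>)) x) +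
         C / \<delta> * (\<Sum>(p, q)\<in>?D. indicator (strip p (2 * \<delta>) \<inter> strip q (2 * \<delta>)) x)"
    using cutoff_flux_bound[OF v R] by blast
  define e1 where "e1 = e / (2 * (C * real (card ?A) + 1))"
  define e2 where "e2 = e / (4 * (C * real (card ?D) + 1))"
  have pos: "C * real (card ?A) + 1 > 0" "C * real (card ?D) + 1 > 0"
    using C(1) by (simp_all add: add_nonneg_pos)
  then have e12: "e1 > 0" "e2 > 0" using \<open>e > 0\<close> by (simp_all add: e1_def e2_def)
  have b1: "C * (real (card ?A) * e1) \<le> e / 2"
    using pos \<open>e > 0\<close> by (simp add: e1_def field_simps)
  have b2: "C * (real (card ?D) * (2 * e2)) \<le> e / 2"
    using pos \<open>e > 0\<close> by (simp add: e2_def field_simps)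
  define m1 where "m1 \<delta> p = measure lebesgue (strip p (2 * \<delta>) \<inter> cball 0 R)" for \<delta> and p :: "'a \<times> real"
  define m2 where "m2 \<delta> p q = measure lebesgue (strip p (2 * \<delta>) \<inter> strip q (2 * \<delta>) \<inter> cball 0 R)"
    for \<delta> and p q :: "'a \<times> real"
  have "\<forall>\<^sub>F \<delta> in at_right 0. m1 \<delta> p \<le> e1" if p: "p \<in> ?A" for p
  proof -
    obtain \<eta> where "\<eta> > 0" "\<And>\<delta>. \<delta> \<le> \<eta> \<Longrightarrow> measure lebesgue (strip p \<delta> \<inter> cball 0 R) \<le> e1"
      using strip_measure_small[OF arrangement_unit[OF p] e12(1)] by blast
    then show ?thesis
      unfolding eventually_at_right_field m1_def by (intro exI[of _ "\<eta> / 2"]) auto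
  qed
  then have ev1: "\<forall>\<^sub>F \<delta> in at_right 0. \<forall>p\<in>?A. m1 \<delta> p \<le> e1"
    using finite_arrangement by (simp add: eventually_ball_finite)
  have "\<forall>\<^sub>F \<delta> in at_right 0. m2 \<delta> (fst i) (snd i) \<le> 2 * e2 * \<delta>" if "i \<in> ?D" for i
  proof -
    have i: "fst i \<in> ?A" "snd i \<in> ?A" "fst i \<noteq> snd i" using that by auto
    obtain \<eta> where \<eta>: "\<eta> > 0" "\<And>\<delta>. 0 < \<delta> \<and> \<delta> \<le> \<eta> \<Longrightarrow>
        measure lebesgue (strip (fst i) \<delta> \<inter> strip (snd i) \<delta> \<inter> cball 0 R) \<le> e2 * \<delta>"
      using two_strips_measure_small[OF arrangement_unit[OF i(1)] arrangement_unit[OF i(2)]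
          arrangement_distinct[OF i] e12(2)] by blast
    have "m2 \<delta> (fst i) (snd i) \<le> 2 * e2 * \<delta>" if "0 < \<delta>" "\<delta> < \<eta> / 2" for \<delta>
      using \<eta>(2)[of "2 * \<delta>"] that by (simp add: m2_def mult_ac)
    with \<eta>(1) show ?thesis
      unfolding eventually_at_right_field by (intro exI[of _ "\<eta> / 2"]) auto
  qed
  then have ev2: "\<forall>\<^sub>F \<delta> in at_right 0. \<forall>i\<in>?D. m2 \<delta> (fst i) (snd i) \<le> 2 * e2 * \<delta>"
    using fD by (intro eventually_ball_finite) auto
  have bound: "\<bar>ip \<Omega> v (gradient (cutoff ?A \<Omega> \<delta>))\<bar> \<le> e"
    if \<delta>: "\<delta> > 0" and m1: "\<forall>p\<in>?A. m1 \<delta> p \<le> e1" and m2: "\<forall>i\<in>?D. m2 \<delta> (fst i) (snd i) \<le> 2 * e2 * \<delta>"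
    for \<delta>
  proof (cases "integrable (lebesgue_on \<Omega>) (\<lambda>x. v x \<bullet> gradient (cutoff ?A \<Omega> \<delta>) x)")
    case False
    \<comment> \<open>The integral of a function that is not integrable is zero by convention.\<close>
    then show ?thesis using \<open>e > 0\<close> by (simp add: ip_def not_integrable_integral_eq)
  next
    case True
    define f where "f x = v x \<bullet> gradient (cutoff ?A \<Omega> \<delta>) x" for x
    define S where "S p = strip p (2 * \<delta>) \<inter> cball 0 R" for p :: "'a \<times> real"
    define W where "W i = strip (fst i) (2 * \<delta>) \<inter> strip (snd i) (2 * \<delta>) \<inter> cball 0 R"
      for i :: "('a \<times> real) \<times> 'a \<times> real"
    define H where "H x = C * (\<Sum>p\<in>?A. indicator (S p) x) + C / \<delta> * (\<Sum>i\<in>?D. indicator (W i) x)" for x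
    have \<Omega>: "\<Omega> \<in> sets lebesgue" using domain_lmeasurable by (rule fmeasurableD)
    have lm: "S p \<in> lmeasurable" "W i \<in> lmeasurable" for p i
      unfolding S_def W_def by (intro lmeasurable_bounded_closed closed_Int closed_strip)+
    have ind: "integrable lebesgue (indicator (S p) :: 'a \<Rightarrow> real)"
      "integrable lebesgue (indicator (W i) :: 'a \<Rightarrow> real)" for p i
      using lm by (auto simp: fmeasurable_def infinity_ennreal_def intro!: integrable_real_indicator
          simp del: emeasure_completion)
    have intH: "integrable lebesgue H"
      unfolding H_def[abs_def]
      by (intro Bochner_Integration.integrable_add Bochner_Integration.integrable_sum integrable_mult_right ind)
    have Heq: "integral\<^sup>L lebesgue H = C * (\<Sum>p\<in>?A. m1 \<delta> p) + C / \<delta> * (\<Sum>i\<in>?D. m2 \<delta> (fst i) (snd i))"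
      unfolding H_def[abs_def] m1_def m2_def S_def[symmetric] W_def[symmetric]
      by (subst Bochner_Integration.integral_add)
        (intro Bochner_Integration.integrable_sum integrable_mult_right ind | simp add: ind Bochner_Integration.integral_sum)+
    have fi: "integrable (lebesgue_on \<Omega>) (\<lambda>x. \<bar>f x\<bar>)" using True by (simp add: f_def)
    have "\<bar>ip \<Omega> v (gradient (cutoff ?A \<Omega> \<delta>))\<bar> \<le> (\<integral>x. \<bar>f x\<bar> \<partial>lebesgue_on \<Omega>)"
      unfolding ip_def f_def by (rule integral_abs_bound)
    also have "\<dots> = (\<integral>x. indicator \<Omega> x *\<^sub>R \<bar>f x\<bar> \<partial>lebesgue)"
      using \<Omega> by (simp add: integral_restrict_space)
    also have "\<dots> \<le> integral\<^sup>L lebesgue H"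
    proof (rule integral_mono_AE)
      show "integrable lebesgue (\<lambda>x. indicator \<Omega> x *\<^sub>R \<bar>f x\<bar>)"
        using fi \<Omega> by (simp add: integrable_restrict_space)
      show "integrable lebesgue H" by (rule intH)
      have "AE x in lebesgue. x \<in> \<Omega> \<longrightarrow> (\<forall>p\<in>?A. x \<notin> hyperplane p)"
        using AE_off_arrangement \<Omega> by (subst (asm) AE_restrict_space_iff) auto
      then show "AE x in lebesgue. indicator \<Omega> x *\<^sub>R \<bar>f x\<bar> \<le> H x"
      proof (rule eventually_mono)
        fix x assume x: "x \<in> \<Omega> \<longrightarrow> (\<forall>p\<in>?A. x \<notin> hyperplane p)"
        show "indicator \<Omega> x *\<^sub>R \<bar>f x\<bar> \<le> H x"
        proof (cases "x \<in> \<Omega>")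
          case False
          then show ?thesis using C(1) \<delta>
            by (simp add: H_def sum_nonneg)
        next
          case True
          then have "x \<in> cball 0 R" using R closure_subset by blast
          then have "indicator (S p) x = (indicator (strip p (2 * \<delta>)) x :: real)"
            "indicator (W i) x = ((case i of (p, q) \<Rightarrow> indicator (strip p (2 * \<delta>) \<inter> strip q (2 * \<delta>)) x) :: real)"
            for p i
            by (auto simp: S_def W_def indicator_def split: prod.splits)
          then have "H x = C * (\<Sum>p\<in>?A. indicator (strip p (2 * \<delta>)) x) +
             C / \<delta> * (\<Sum>(p, q)\<in>?D. indicator (strip p (2 * \<delta>) \<inter> strip q (2 * \<delta>)) x)"
            by (simp only: H_def)
          with C(2)[OF \<delta> True] x True show ?thesis by (simp add: f_def)
        qed
      qed
    qed
    also have "\<dots> \<le> C * (real (card ?A) * e1) + C / \<delta> * (real (card ?D) * (2 * e2 * \<delta>))"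
    proof -
      have "(\<Sum>p\<in>?A. m1 \<delta> p) \<le> real (card ?A) * e1"
        by (rule sum_bounded_above) (use m1 in blast)
      moreover have "(\<Sum>i\<in>?D. m2 \<delta> (fst i) (snd i)) \<le> real (card ?D) * (2 * e2 * \<delta>)"
        by (rule sum_bounded_above) (use m2 in blast)
      ultimately show ?thesis
        unfolding Heq using C(1) \<delta> by (intro add_mono mult_left_mono) auto
    qed
    also have "\<dots> = C * (real (card ?A) * e1) + C * (real (card ?D) * (2 * e2))"
      using \<delta> by simp
    also have "\<dots> \<le> e" using b1 b2 by linarith
    finally show ?thesis .
  qed
  have "\<forall>\<^sub>F \<delta> in at_right (0::real). \<delta> > 0" by (rule eventually_at_right_less)
  with ev1 ev2 show ?thesis
    by eventually_elim (rule bound)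
qed

text \<open>Once \<open>2 \<delta>\<close> is less than the distance from \<open>x\<close> to each hyperplane, the signs at \<open>x\<close> determine a
  single chamber, which is contained in the cell of \<open>x\<close>.\<close>

lemma cutoff_tendsto_1:
  assumes x: "x \<in> \<Omega>" "\<And>p. p \<in> arrangement \<Longrightarrow> x \<notin> hyperplane p"
  shows "\<forall>\<^sub>F \<delta> in at_right 0. cutoff arrangement \<Omega> \<delta> x = 1"
proof -
  let ?A = arrangement
  let ?Q = "{z. \<forall>q\<in>?A. 0 < sgn (level q x) * level q z}"
  have "x \<in> closure \<Omega>" using x(1) closure_subset by blast
  then obtain K where K: "K \<in> \<T>" "x \<in> interior K"
    using generic_point_in_cell x(2) by blast
  have "?Q \<subseteq> interior K"
  proof (rule chamber_in_cell[OF K(1)])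
    have "?Q = (\<Inter>q\<in>?A. {z. (sgn (level q x) *\<^sub>R fst q) \<bullet> z > sgn (level q x) * snd q})"
      by (auto simp: algebra_simps)
    then show "convex ?Q" by (simp only:) (intro convex_INT convex_halfspace_gt)
    have "x \<in> ?Q" using x(2) by (fastforce intro: sgn_times_self_pos)
    then show "?Q \<inter> K \<noteq> {}" using K(2) interior_subset by blast
    show "?Q \<inter> hyperplane p = {}" if "p \<in> ?A" for p
    proof -
      have "0 < sgn (level p x) * level p z" if "z \<in> ?Q" for z
        using that \<open>p \<in> ?A\<close> by simp
      then show ?thesis by force
    qed
  qed
  then have sub: "?Q \<subseteq> \<Omega>" using cell(6)[OF K(1)] by blast
  have "\<forall>\<^sub>F \<delta> in at_right 0. 2 * \<delta> < \<bar>level q x\<bar>" if "q \<in> ?A" for q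
    unfolding eventually_at_right_field
    using x(2)[OF that] by (intro exI[of _ "\<bar>level q x\<bar> / 2"]) auto
  then have "\<forall>\<^sub>F \<delta> in at_right 0. \<forall>q\<in>?A. 2 * \<delta> < \<bar>level q x\<bar>"
    using finite_arrangement by (intro eventually_ball_finite) auto
  moreover have "\<forall>\<^sub>F \<delta> in at_right (0::real). \<delta> > 0" by (rule eventually_at_right_less)
  ultimately show ?thesis
  proof eventually_elim
    case (elim \<delta>)
    then have "x \<in> far_neighbourhood ?A \<delta> x" by (intro far_neighbourhood_self) auto
    then show ?case
      using cutoff_eq_1[OF finite_arrangement elim(2) subset_refl _ sub] by blast
  qed
qed

text \<open>The divergence theorem for weak divergences: the cutoffs are admissible test functions, dominated
  convergence gives the integral of \<open>g\<close> on the left, and the right-hand side vanishes in the limit.\<close>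

lemma total_divergence_zero:
  assumes v: "piecewise_polynomial \<T> v" "normal_vanishes \<Omega> \<T> v"
    and g: "has_weak_divergence \<Omega> v g"
  shows "(\<integral>x. g x \<partial>lebesgue_on \<Omega>) = 0"
proof -
  let ?A = arrangement
  define \<delta> where "\<delta> n = inverse (real (Suc n))" for n
  have \<delta>: "filterlim \<delta> (at_right 0) sequentially"
    unfolding filterlim_at \<delta>_def using LIMSEQ_inverse_real_of_nat by auto
  let ?\<theta> = "\<lambda>n. cutoff ?A \<Omega> (\<delta> n)"
  have gi: "integrable (lebesgue_on \<Omega>) g"
    using g domain_lmeasurable by (auto simp: has_weak_divergence_def intro: square_integrable_integrable)
  have meas: "?\<theta> n \<in> borel_measurable (lebesgue_on \<Omega>)" for n
    using domain_lmeasurable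
    by (intro continuous_imp_measurable_on_sets_lebesgue continuous_on_smooth smooth_cutoff) (rule fmeasurableD)
  have "(\<lambda>n. \<integral>x. g x * ?\<theta> n x \<partial>lebesgue_on \<Omega>) \<longlonglongrightarrow> (\<integral>x. g x \<partial>lebesgue_on \<Omega>)"
  proof (rule integral_dominated_convergence)
    show "integrable (lebesgue_on \<Omega>) (\<lambda>x. \<bar>g x\<bar>)" using gi by simp
    show "g \<in> borel_measurable (lebesgue_on \<Omega>)" using gi by simp
    then show "(\<lambda>x. g x * ?\<theta> n x) \<in> borel_measurable (lebesgue_on \<Omega>)" for n
      using meas by (rule borel_measurable_times)
    show "AE x in lebesgue_on \<Omega>. norm (g x * ?\<theta> n x) \<le> \<bar>g x\<bar>" for n
      using cutoff_range[OF finite_arrangement, of \<Omega> "\<delta> n"] by (auto simp: abs_mult mult_left_le)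
    have "AE x in lebesgue_on \<Omega>. x \<in> \<Omega>" by (rule AE_I2) simp
    with AE_off_arrangement show "AE x in lebesgue_on \<Omega>. (\<lambda>n. g x * ?\<theta> n x) \<longlonglongrightarrow> g x"
    proof eventually_elim
      case (elim x)
      then have "\<forall>\<^sub>F n in sequentially. ?\<theta> n x = 1"
        using filterlim_iff[THEN iffD1, OF \<delta>] cutoff_tendsto_1[of x] by blast
      then have "\<forall>\<^sub>F n in sequentially. g x * ?\<theta> n x = g x"
        by eventually_elim simp
      then show ?case by (rule tendsto_eventually)
    qed
  qed
  moreover have "(\<integral>x. g x * ?\<theta> n x \<partial>lebesgue_on \<Omega>) = - ip \<Omega> v (gradient (?\<theta> n))" for n
  proof -
    have "test_function \<Omega> (?\<theta> n)"
      using finite_arrangement bounded_domain by (intro test_function_cutoff) (auto simp: \<delta>_def)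
    with g show ?thesis by (auto simp: has_weak_divergence_def ip_def)
  qed
  ultimately have lim: "(\<lambda>n. - ip \<Omega> v (gradient (?\<theta> n))) \<longlonglongrightarrow> (\<integral>x. g x \<partial>lebesgue_on \<Omega>)" by simp
  have "(\<lambda>n. ip \<Omega> v (gradient (?\<theta> n))) \<longlonglongrightarrow> 0"
  proof (rule tendstoI)
    fix e :: real assume "e > 0"
    then have "\<forall>\<^sub>F d in at_right 0. \<bar>ip \<Omega> v (gradient (cutoff ?A \<Omega> d))\<bar> \<le> e / 2"
      by (intro cutoff_flux_small v) simp
    then have "\<forall>\<^sub>F n in sequentially. \<bar>ip \<Omega> v (gradient (?\<theta> n))\<bar> \<le> e / 2"
      using filterlim_iff[THEN iffD1, OF \<delta>] by blast
    then show "\<forall>\<^sub>F n in sequentially. dist (ip \<Omega> v (gradient (?\<theta> n))) 0 < e"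
      by eventually_elim (use \<open>e > 0\<close> in simp)
  qed
  from tendsto_minus[OF this] show ?thesis
    using LIMSEQ_unique[OF lim] by simp
qed

end

section \<open>Conservation of mass\<close>

text \<open>The mass is a continuous linear functional on \<open>L\<^sup>2\<close>, so it commutes with the time derivative.\<close>

lemma integral_has_time_derivative:
  assumes \<Omega>: "\<Omega> \<in> lmeasurable" and f: "\<And>s. s \<in> I \<Longrightarrow> square_integrable \<Omega> (f s)"
    and "t \<in> I" and der: "has_time_derivative \<Omega> I f t f'"
  shows "((\<lambda>s. \<integral>x. f s x \<partial>lebesgue_on \<Omega>) has_real_derivative (\<integral>x. f' x \<partial>lebesgue_on \<Omega>)) (at t within I)"
  unfolding has_field_derivative_iff
proof (rule Lim_null[THEN iffD2], rule Lim_null_comparison)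
  let ?J = "\<lambda>h. \<integral>x. h x \<partial>lebesgue_on \<Omega>"
  let ?r = "\<lambda>s x. (f s x - f t x) / (s - t) - f' x"
  have f': "square_integrable \<Omega> f'" using der by (simp add: has_time_derivative_def)
  show "((\<lambda>s. sqrt (measure lebesgue \<Omega>) * l2norm \<Omega> (?r s)) \<longlongrightarrow> 0) (at t within I)"
    using der by (intro tendsto_mult_right_zero) (simp add: has_time_derivative_def)
  have "norm ((?J (f s) - ?J (f t)) / (s - t) - ?J f') \<le> sqrt (measure lebesgue \<Omega>) * l2norm \<Omega> (?r s)"
    if "s \<in> I" for s
  proof -
    have r: "?r s = (\<lambda>x. (1 / (s - t)) *\<^sub>R (f s x + (- 1) *\<^sub>R f t x) + (- 1) *\<^sub>R f' x)"
      by (simp add: fun_eq_iff)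
    have "square_integrable \<Omega> (?r s)"
      unfolding r using that \<open>t \<in> I\<close> f f' by (intro square_integrable_add square_integrable_scaleR) auto
    moreover have "?J (?r s) = (?J (f s) - ?J (f t)) / (s - t) - ?J f'"
      using that \<open>t \<in> I\<close> f f' \<Omega> by (simp add: square_integrable_integrable)
    ultimately show ?thesis
      using abs_integral_le_l2norm[OF _ \<Omega>, of "?r s"] by simp
  qed
  then show "\<forall>\<^sub>F s in at t within I. norm ((?J (f s) - ?J (f t)) / (s - t) - ?J f')
      \<le> sqrt (measure lebesgue \<Omega>) * l2norm \<Omega> (?r s)"
    by (auto simp: eventually_at_filter)
qed

context polytopal_mesh
begin

lemma integral_eq_ip_one:
  assumes one: "\<And>K x. K \<in> \<T> \<Longrightarrow> x \<in> interior K \<Longrightarrow> \<psi> x = 1"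
    and \<psi>: "\<psi> \<in> borel_measurable (lebesgue_on \<Omega>)" and h: "h \<in> borel_measurable (lebesgue_on \<Omega>)"
  shows "ip \<Omega> \<psi> h = (\<integral>x. h x \<partial>lebesgue_on \<Omega>)"
  unfolding ip_def
proof (rule integral_cong_AE)
  show "(\<lambda>x. \<psi> x \<bullet> h x) \<in> borel_measurable (lebesgue_on \<Omega>)" "h \<in> borel_measurable (lebesgue_on \<Omega>)"
    using \<psi> h by auto
  have "AE x in lebesgue_on \<Omega>. x \<in> \<Omega>" by (rule AE_I2) simp
  with AE_off_arrangement show "AE x in lebesgue_on \<Omega>. \<psi> x \<bullet> h x = h x"
  proof eventually_elim
    case (elim x)
    then have "x \<in> closure \<Omega>" using closure_subset by blast
    then obtain K where "K \<in> \<T>" "x \<in> interior K"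
      using elim(1) generic_point_in_cell by blast
    then show ?case using one by simp
  qed
qed

lemma broken_gradient_one:
  assumes one: "\<And>K x. K \<in> \<T> \<Longrightarrow> x \<in> interior K \<Longrightarrow> \<psi> x = 1"
  shows "broken_gradient \<T> \<psi> x = 0"
proof (cases "\<exists>K\<in>\<T>. x \<in> interior K")
  case True
  then obtain K where K: "K \<in> \<T>" "x \<in> interior K" by blast
  have "GDERIV \<psi> x :> 0"
    by (rule GDERIV_cong_open[OF GDERIV_const[of 1] open_interior K(2)]) (use one K(1) in auto)
  then show ?thesis using gradient_eq by (auto simp: broken_gradient_def)
qed (simp add: broken_gradient_def)

text \<open>With \<open>\<psi> = 1\<close> the jump is that of \<open>u\<close>, and its two terms cancel whatever the upwind value is.\<close>

lemma facet_flux_one: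
  assumes one: "\<And>K x. K \<in> \<T> \<Longrightarrow> x \<in> interior K \<Longrightarrow> \<psi> x = 1"
    and lab: "facet_labelling \<T> Kp Km" and F: "F \<in> interior_facets \<T>" and u: "normal_continuous \<T> u"
  shows "(\<integral>x. facet_flux Kp Km F u \<phi> \<psi> x \<partial>facet_measure F) = 0"
proof (rule integral_eq_zero_AE)
  have K: "Kp F \<in> \<T>" "F facet_of Kp F" "Km F \<in> \<T>" "F facet_of Km F" "Kp F \<noteq> Km F"
    using lab F by (auto simp: facet_labelling_def)
  have tr: "side_trace K (\<lambda>y. \<psi> y *\<^sub>R u y) x = side_trace K u x" if "K \<in> \<T>" for K x
    by (rule side_trace_cong) (use one that in auto)
  have "AE x in facet_measure F.
      side_trace (Kp F) u x \<bullet> outer_normal (Kp F) F = side_trace (Km F) u x \<bullet> outer_normal (Kp F) F"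
    using u K unfolding normal_continuous_def by blast
  then show "AE x in facet_measure F. facet_flux Kp Km F u \<phi> \<psi> x = 0"
    by eventually_elim
      (simp add: facet_flux_def jump_def tr K outer_normals_opposite[OF K])
qed

end

theorem proposition3p2:
  fixes \<Omega> :: "'a::euclidean_space set"
    and \<T> :: "'a set set"
    and Kp Km :: "'a set \<Rightarrow> 'a set"
    and VH VU :: "('a \<Rightarrow> 'a) set"
    and VD :: "('a \<Rightarrow> real) set"
    and \<epsilon> :: real
    and d :: "real \<Rightarrow> real"
    and I :: "real set"
    and u :: "real \<Rightarrow> 'a \<Rightarrow> 'a"
    and S :: "real \<Rightarrow> 'a \<Rightarrow> real"
    and \<phi> \<mu> :: "real \<Rightarrow> 'a \<Rightarrow> real"
    and j \<sigma> :: "real \<Rightarrow> 'a \<Rightarrow> 'a"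
  assumes "DIM('a) \<ge> 2"
    and "lipschitz_domain \<Omega>"
    and "fe_mesh \<Omega> \<T>"
    and "facet_labelling \<T> Kp Km"
    and "compatible_spaces \<Omega> \<T> VH VD"
    and "\<epsilon> > 0"
    and "continuous_on UNIV d" and "\<And>s. d s > 0"
    and "is_interval I" and "interior I \<noteq> {}"
    and "\<And>t. t \<in> I \<Longrightarrow> square_integrable \<Omega> (S t)"
    and "velocity_space \<Omega> \<T> VU"
    and "\<And>t. t \<in> I \<Longrightarrow> u t \<in> VU"
    and "L2_continuous \<Omega> I u"
    and "\<And>t \<psi> F. \<lbrakk>t \<in> I; \<psi> \<in> VD; F \<in> interior_facets \<T>\<rbrakk> \<Longrightarrow>
           integrable (facet_measure F) (facet_flux Kp Km F (u t) (\<phi> t) \<psi>)"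
    and "DG_CH_flow \<Omega> \<T> Kp Km VH VD \<epsilon> d I u S \<phi> j \<mu> \<sigma>"
  shows "\<forall>t\<in>I. ((\<lambda>s. \<integral>x. \<phi> s x \<partial>lebesgue_on \<Omega>) has_real_derivative
                   (\<integral>x. S t x \<partial>lebesgue_on \<Omega>)) (at t within I)"
proof
  fix t assume t: "t \<in> I"
  interpret polytopal_mesh \<Omega> \<T>
    using assms(2,3) by unfold_locales
  note sol = assms(16)[unfolded DG_CH_flow_def, rule_format, OF t]
  obtain \<psi> where \<psi>: "\<psi> \<in> VD" "\<And>K x. K \<in> \<T> \<Longrightarrow> x \<in> interior K \<Longrightarrow> \<psi> x = 1"
    using assms(5) unfolding compatible_spaces_def DG_space_def by meson
  have VD: "square_integrable \<Omega> \<eta>" if "\<eta> \<in> VD" for \<eta>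
    using assms(5) that piecewise_polynomial_square_integrable
    by (auto simp: compatible_spaces_def DG_space_def)
  have j: "j t \<in> VH" "normal_vanishes \<Omega> \<T> (j t)" "piecewise_polynomial \<T> (j t)"
    using sol assms(5) by (auto simp: Hdiv0_def compatible_spaces_def)
  have div: "has_weak_divergence \<Omega> (j t) (weak_div \<Omega> (j t))"
  proof -
    have "\<exists>g. has_weak_divergence \<Omega> (j t) g"
      using assms(5) j(1) unfolding compatible_spaces_def by blast
    then show ?thesis unfolding weak_div_def by (rule someI_ex)
  qed
  obtain \<phi>' where der: "has_time_derivative \<Omega> I \<phi> t \<phi>'"
    and eq: "\<And>\<psi>. \<psi> \<in> VD \<Longrightarrow> ip \<Omega> \<psi> (\<lambda>x. \<phi>' x + weak_div \<Omega> (j t) x)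
          - ip \<Omega> (broken_gradient \<T> \<psi>) (\<lambda>x. \<phi> t x *\<^sub>R u t x)
          + (\<Sum>F\<in>interior_facets \<T>. \<integral>x. facet_flux Kp Km F (u t) (\<phi> t) \<psi> x \<partial>facet_measure F)
          = ip \<Omega> \<psi> (S t)"
    using sol by blast
  have si: "square_integrable \<Omega> \<phi>'" "square_integrable \<Omega> (weak_div \<Omega> (j t))" "square_integrable \<Omega> (S t)"
    using der div assms(11)[OF t] by (auto simp: has_time_derivative_def has_weak_divergence_def)
  have meas: "\<phi>' \<in> borel_measurable (lebesgue_on \<Omega>)" "weak_div \<Omega> (j t) \<in> borel_measurable (lebesgue_on \<Omega>)"
    "S t \<in> borel_measurable (lebesgue_on \<Omega>)" "\<psi> \<in> borel_measurable (lebesgue_on \<Omega>)"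
    using si VD[OF \<psi>(1)] by (auto simp: square_integrable_def)
  have "normal_continuous \<T> (u t)"
    using assms(12,13) t by (auto simp: velocity_space_def)
  then have facets: "(\<Sum>F\<in>interior_facets \<T>. \<integral>x. facet_flux Kp Km F (u t) (\<phi> t) \<psi> x \<partial>facet_measure F) = 0"
    using assms(4) \<psi>(2) by (intro sum.neutral ballI facet_flux_one) auto
  have transport: "ip \<Omega> (broken_gradient \<T> \<psi>) (\<lambda>x. \<phi> t x *\<^sub>R u t x) = 0"
    by (simp add: ip_def broken_gradient_one[of \<psi>, OF \<psi>(2)])
  have "(\<integral>x. S t x \<partial>lebesgue_on \<Omega>) = ip \<Omega> \<psi> (S t)"
    using integral_eq_ip_one[of \<psi>, OF \<psi>(2)] meas by simp
  also have "\<dots> = ip \<Omega> \<psi> (\<lambda>x. \<phi>' x + weak_div \<Omega> (j t) x)"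
    using eq[OF \<psi>(1)] facets transport by simp
  also have "\<dots> = (\<integral>x. \<phi>' x + weak_div \<Omega> (j t) x \<partial>lebesgue_on \<Omega>)"
    using integral_eq_ip_one[of \<psi>, OF \<psi>(2)] meas by simp
  also have "\<dots> = (\<integral>x. \<phi>' x \<partial>lebesgue_on \<Omega>)"
    using si total_divergence_zero[OF j(3,2) div] domain_lmeasurable
    by (simp add: square_integrable_integrable)
  finally show "((\<lambda>s. \<integral>x. \<phi> s x \<partial>lebesgue_on \<Omega>) has_real_derivative (\<integral>x. S t x \<partial>lebesgue_on \<Omega>)) (at t within I)"
    using integral_has_time_derivative[OF domain_lmeasurable _ t der] VD assms(16)
    by (simp add: DG_CH_flow_def)
qed

end
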